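(* Let $p$ be a prime, let $q$ and $r$ be powers of $p$ with $r>2$, and let $F=\mathbb{F}_q((t))$. Let $$G_2=\left\{\begin{pmatrix}1&y^r&z\\0&1&y\\0&0&1\end{pmatrix} : y,z\in F\right\}.$$ Let $\Gamma$ be an arithmetic lattice in $G_2$ and let $\lambda$ be a virtual automorphism of $\Gamma$. Then there exist a standard automorphism $\phi_{\tau,a}$ of $G_2$, a finite-index subgroup $\Gamma'$ of $\Gamma$, and a homomorphism $\zeta\colon\Gamma'\to Z(\Gamma)$, such that $\lambda(\gamma)=\phi_{\tau,a}(\gamma)\,\zeta(\gamma)$ for all $\gamma\in\Gamma'$.
   Context: $F^-=\mathbb{F}_q[t^{-1}]\subset F$. A subgroup $\Gamma$ of a closed subgroup $G\subset \mathrm{GL}(n,F)$ is arithmetic if it is commensurable with $\mathrm{GL}(n,F^-)\cap G$, i.e. $\Gamma\cap \mathrm{GL}(n,F^-)$ has finite index in both $\Gamma$ and $\mathrm{GL}(n,F^-)\cap G$. A lattice is a discrete subgroup $\Gamma$ of $G$ with $G/\Gamma$ compact; arithmetic subgroups of $G_2$ are lattices. A virtual automorphism of the discrete group $\Gamma$ is a group isomorphism $\lambda\colon\Gamma_1\to\Gamma_2$ between two finite-index subgroups $\Gamma_1,\Gamma_2$ of $\Gamma$ (in the theorem, $\Gamma'$ is contained in the domain $\Gamma_1$ of $\lambda$). $Z(\cdot)$ denotes the center. For a continuous field automorphism $\tau$ of $F$ and $a\in F\setminus\{0\}$, the continuous automorphism $\phi_{\tau,a}$ of $G_2$ is $$\phi_{\tau,a}\begin{pmatrix}1&y^r&z\\0&1&y\\0&0&1\end{pmatrix}=\begin{pmatrix}1&a^r\tau(y)^r&a^{r+1}\tau(z)\\0&1&a\tau(y)\\0&0&1\end{pmatrix}.$$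 It is called standard if (1) there exist $\sigma\in\mathrm{Gal}(\mathbb{F}_q/\mathbb{F}_p)$, $\alpha\in\mathbb{F}_q\setminus\{0\}$, $\beta\in\mathbb{F}_q$ with $\tau(f(t^{-1}))=\sigma(f(\alpha t^{-1}+\beta))$ for all $f(t^{-1})\in F$ (where $\sigma$ acts on the coefficients of a Laurent series), and (2) there is a nonzero $b\in F^-$ with $ab\in F^-$. *)

theory Defs
  imports
    "HOL-Analysis.Analysis"
    "HOL-Algebra.Left_Coset"
    "HOL-Computational_Algebra.Computational_Algebra"
begin

text \<open>
  Throughout, \<open>'a\<close> is a finite field with \<open>q\<close> elements and \<open>F\<close> is the field \<open>'a fls\<close> of formal
  Laurent series in \<open>t\<close> = \<^term>\<open>fls_X\<close>, with the \<open>t\<close>-adic topology given by its \<open>metric_space\<close>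
  instance.  Matrices carry the product topology.
\<close>

section \<open>Abstract groups\<close>

definition finite_index_subgroup :: "'g set \<Rightarrow> ('g, 'm) monoid_scheme \<Rightarrow> bool" where
  "finite_index_subgroup H G \<longleftrightarrow> subgroup H G \<and> finite (rcosets\<^bsub>G\<^esub> H)"

definition group_center :: "('g, 'm) monoid_scheme \<Rightarrow> 'g set" where
  "group_center G = {z \<in> carrier G. \<forall>g \<in> carrier G. z \<otimes>\<^bsub>G\<^esub> g = g \<otimes>\<^bsub>G\<^esub> z}"

text \<open>Only the values of \<open>lam\<close> on its domain \<open>G1\<close> matter.\<close>

definition virtual_automorphism ::
    "('g, 'm) monoid_scheme \<Rightarrow> 'g set \<Rightarrow> ('g \<Rightarrow> 'g) \<Rightarrow> bool" where
  "virtual_automorphism G G1 lam \<longleftrightarrow>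
     finite_index_subgroup G1 G \<and>
     (\<exists>G2. finite_index_subgroup G2 G \<and>
           lam \<in> iso (G\<lparr>carrier := G1\<rparr>) (G\<lparr>carrier := G2\<rparr>))"

section \<open>Quotient topology\<close>

definition quotient_topology :: "'b topology \<Rightarrow> ('b \<Rightarrow> 'c) \<Rightarrow> 'c topology" where
  "quotient_topology X f =
     topology (\<lambda>U. U \<subseteq> f ` topspace X \<and> openin X {x \<in> topspace X. f x \<in> U})"

lemma openin_quotient_topology:
  "openin (quotient_topology X f) U \<longleftrightarrow>
     U \<subseteq> f ` topspace X \<and> openin X {x \<in> topspace X. f x \<in> U}"
proof -
  have "istopology (\<lambda>U. U \<subseteq> f ` topspace X \<and> openin X {x \<in> topspace X. f x \<in> U})"
    unfolding istopology_def
  proof (intro conjI allI impI; (elim conjE)?)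
    fix S T
    assume "openin X {x \<in> topspace X. f x \<in> S}" "openin X {x \<in> topspace X. f x \<in> T}"
    then have "openin X ({x \<in> topspace X. f x \<in> S} \<inter> {x \<in> topspace X. f x \<in> T})"
      by (rule openin_Int)
    also have "{x \<in> topspace X. f x \<in> S} \<inter> {x \<in> topspace X. f x \<in> T} =
               {x \<in> topspace X. f x \<in> S \<inter> T}" by blast
    finally show "openin X {x \<in> topspace X. f x \<in> S \<inter> T}" .
  next
    fix K
    assume "\<forall>S\<in>K. S \<subseteq> f ` topspace X \<and> openin X {x \<in> topspace X. f x \<in> S}"
    then have "openin X (\<Union>S\<in>K. {x \<in> topspace X. f x \<in> S})" by blast
    also have "(\<Union>S\<in>K. {x \<in> topspace X. f x \<in> S}) = {x \<in> topspace X. f x \<in> \<Union> K}" by blast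
    finally show "openin X {x \<in> topspace X. f x \<in> \<Union> K}" .
  qed blast+
  then show ?thesis
    by (simp add: quotient_topology_def topology_inverse')
qed

lemma topspace_quotient_topology [simp]: "topspace (quotient_topology X f) = f ` topspace X"
proof -
  have "{x \<in> topspace X. f x \<in> f ` topspace X} = topspace X" by blast
  then have "openin (quotient_topology X f) (f ` topspace X)"
    by (simp add: openin_quotient_topology)
  then show ?thesis
    by (metis openin_quotient_topology openin_subset openin_topspace subset_antisym)
qed

lemma quotient_map_quotient_topology: "quotient_map X (quotient_topology X f) f"
  by (auto simp: quotient_map_def openin_quotient_topology)

section \<open>Matrix groups\<close>

definition matrix_group :: "('b::field ^ 'n ^ 'n) set \<Rightarrow> ('b ^ 'n ^ 'n) monoid" where
  "matrix_group A = \<lparr>carrier = A, mult = (**), one = mat 1\<rparr>"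

definition GL_over :: "'b::field set \<Rightarrow> ('b ^ 'n ^ 'n) set" where
  "GL_over R = {A. (\<forall>i j. A $ i $ j \<in> R) \<and>
                   (\<exists>B. (\<forall>i j. B $ i $ j \<in> R) \<and> A ** B = mat 1 \<and> B ** A = mat 1)}"

text \<open>The subring \<open>\<F>\<^sub>q[t\<^sup>-\<^sup>1]\<close> of \<open>F\<close>: polynomials over \<open>'a\<close> evaluated at \<open>t\<^sup>-\<^sup>1\<close>.\<close>

definition F_minus :: "'a::field fls set" where
  "F_minus = range (\<lambda>P :: 'a poly. poly (map_poly fls_const P) fls_X_inv)"

definition arithmetic_subgroup ::
    "('a::field fls ^ 'n ^ 'n) set \<Rightarrow> ('a fls ^ 'n ^ 'n) set \<Rightarrow> bool" where
  "arithmetic_subgroup \<Gamma> G \<longleftrightarrow>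
     subgroup \<Gamma> (matrix_group G) \<and>
     finite_index_subgroup (\<Gamma> \<inter> GL_over F_minus) (matrix_group \<Gamma>) \<and>
     finite_index_subgroup (\<Gamma> \<inter> GL_over F_minus) (matrix_group (GL_over F_minus \<inter> G))"

definition lattice_in ::
    "('a::field fls ^ 'n ^ 'n) set \<Rightarrow> ('a fls ^ 'n ^ 'n) set \<Rightarrow> bool" where
  "lattice_in \<Gamma> G \<longleftrightarrow>
     subgroup \<Gamma> (matrix_group G) \<and> discrete \<Gamma> \<and>
     compact_space (quotient_topology (top_of_set G) (\<lambda>g. g <#\<^bsub>matrix_group G\<^esub> \<Gamma>))"

section \<open>The group \<open>G\<^sub>2\<close> and its standard automorphisms\<close>

definition G2_mat :: "nat \<Rightarrow> 'b::field \<Rightarrow> 'b \<Rightarrow> 'b ^ 3 ^ 3" where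
  "G2_mat r y z = vector [vector [1, y ^ r, z], vector [0, 1, y], vector [0, 0, 1]]"

definition G2_set :: "nat \<Rightarrow> ('b::field ^ 3 ^ 3) set" where
  "G2_set r = {G2_mat r y z | y z. True}"

lemma G2_mat_nth:
  "G2_mat r y z $ 1 = vector [1, y ^ r, z]" "G2_mat r y z $ 2 = vector [0, 1, y]"
  "G2_mat r y z $ 3 = vector [0, 0, 1]"
  by (simp_all add: G2_mat_def)

lemma G2_mat_mult:
  fixes y z y' z' :: "'b::field"
  assumes "prime p" "CHAR('b) = p" "r = p ^ k"
  shows "G2_mat r y z ** G2_mat r y' z' = G2_mat r (y + y') (z + z' + y ^ r * y')"
proof -
  have "(y + y') ^ r = y ^ r + y' ^ r"
    using freshmans_dream'[of r k y y'] assms by simp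
  then show ?thesis
    by (simp add: vec_eq_iff forall_3 matrix_matrix_mult_def sum_3 G2_mat_nth algebra_simps)
qed

lemma group_G2:
  assumes "prime p" "CHAR('b::field) = p" "r = p ^ k"
  shows "group (matrix_group (G2_set r :: ('b ^ 3 ^ 3) set))"
proof (rule groupI)
  let ?G = "matrix_group (G2_set r :: ('b ^ 3 ^ 3) set)"
  have "p > 0" using assms(1) prime_gt_0_nat by blast
  then have "r > 0" using assms(3) by simp
  then have one: "mat 1 = G2_mat r (0::'b) 0"
    by (simp add: vec_eq_iff forall_3 mat_def G2_mat_nth)
  note mult = G2_mat_mult[OF assms]
  show "x \<otimes>\<^bsub>?G\<^esub> y \<in> carrier ?G" if "x \<in> carrier ?G" "y \<in> carrier ?G" for x y
    using that mult by (fastforce simp: matrix_group_def G2_set_def)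
  show "\<one>\<^bsub>?G\<^esub> \<in> carrier ?G"
    using one by (auto simp: matrix_group_def G2_set_def)
  show "\<exists>y\<in>carrier ?G. y \<otimes>\<^bsub>?G\<^esub> x = \<one>\<^bsub>?G\<^esub>" if x_in: "x \<in> carrier ?G" for x
  proof -
    obtain y z where x: "x = G2_mat r y z"
      using x_in by (auto simp: matrix_group_def G2_set_def)
    have "G2_mat r (- y) (- z - (- y) ^ r * y) ** x = mat 1"
      by (simp add: x mult one)
    then show ?thesis
      by (auto simp: matrix_group_def G2_set_def)
  qed
qed (auto simp: matrix_group_def matrix_mul_assoc)

definition field_automorphism :: "('b::field \<Rightarrow> 'b) \<Rightarrow> bool" where
  "field_automorphism f \<longleftrightarrow>
     bij f \<and> f 1 = 1 \<and> (\<forall>x y. f (x + y) = f x + f y) \<and> (\<forall>x y. f (x * y) = f x * f y)"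

text \<open>The map \<open>\<phi>\<^sub>\<tau>\<^sub>,\<^sub>a\<close>: the coordinates \<open>y\<close> and \<open>z\<close> of an element \<open>M\<close> of \<open>G\<^sub>2\<close> are its entries
  \<open>M $ 2 $ 3\<close> and \<open>M $ 1 $ 3\<close>.  The values off \<open>G\<^sub>2\<close> are irrelevant.\<close>

definition phi :: "nat \<Rightarrow> ('b::field \<Rightarrow> 'b) \<Rightarrow> 'b \<Rightarrow> 'b ^ 3 ^ 3 \<Rightarrow> 'b ^ 3 ^ 3" where
  "phi r \<tau> a M =
     (let y = M $ 2 $ 3; z = M $ 1 $ 3 in
      vector [vector [1, a ^ r * \<tau> y ^ r, a ^ (r + 1) * \<tau> z],
              vector [0, 1, a * \<tau> y],
              vector [0, 0, 1]])"

lemma phi_G2_mat: "phi r \<tau> a (G2_mat r y z) = G2_mat r (a * \<tau> y) (a ^ (r + 1) * \<tau> z)"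
  by (simp add: phi_def G2_mat_def power_mult_distrib)

text \<open>The prime field \<open>\<F>\<^sub>p\<close> is the image of the integers.\<close>

definition galois_over_prime_field :: "('a::field \<Rightarrow> 'a) \<Rightarrow> bool" where
  "galois_over_prime_field \<sigma> \<longleftrightarrow> field_automorphism \<sigma> \<and> (\<forall>k::int. \<sigma> (of_int k) = of_int k)"

text \<open>
  The substitution \<open>t\<^sup>-\<^sup>1 \<mapsto> \<alpha> t\<^sup>-\<^sup>1 + \<beta>\<close> is the substitution \<open>t \<mapsto> (\<alpha> t\<^sup>-\<^sup>1 + \<beta>)\<^sup>-\<^sup>1\<close> into a Laurent
  series in \<open>t\<close>.  For \<open>\<alpha> \<noteq> 0\<close> the series \<open>(\<alpha> t\<^sup>-\<^sup>1 + \<beta>)\<^sup>-\<^sup>1\<close> is a power series of order 1 (lemma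
  \<open>subst_series\<close> below), so that \<^const>\<open>fls_compose_fps\<close> is a genuine composition.
\<close>

definition affine_subst :: "'a::field \<Rightarrow> 'a \<Rightarrow> 'a fls \<Rightarrow> 'a fls" where
  "affine_subst \<alpha> \<beta> f =
     fls_compose_fps f (fls_regpart (inverse (fls_const \<alpha> * fls_X_inv + fls_const \<beta>)))"

definition standard :: "('a::field fls \<Rightarrow> 'a fls) \<Rightarrow> 'a fls \<Rightarrow> bool" where
  "standard \<tau> a \<longleftrightarrow>
     (\<exists>\<sigma> \<alpha> \<beta>. galois_over_prime_field \<sigma> \<and> \<alpha> \<noteq> 0 \<and>
        (\<forall>f n. fls_nth (\<tau> f) n = \<sigma> (fls_nth (affine_subst \<alpha> \<beta> f) n))) \<and>
     (\<exists>b \<in> F_minus. b \<noteq> 0 \<and> a * b \<in> F_minus)"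

lemma subst_series:
  fixes \<alpha> \<beta> :: "'a::field"
  assumes "\<alpha> \<noteq> 0"
  defines "s \<equiv> inverse (fls_const \<alpha> * fls_X_inv + fls_const \<beta>)"
  shows "fps_to_fls (fls_regpart s) = s" and "fls_subdegree s = 1"
proof -
  let ?g = "fls_const \<alpha> * fls_X_inv + fls_const \<beta>"
  have "fls_subdegree ?g = -1"
  proof (rule fls_subdegree_eqI)
    show "fls_nth ?g (-1) \<noteq> 0" using assms by simp
    show "fls_nth ?g k = 0" if "k < -1" for k using that by simp
  qed
  then show sub: "fls_subdegree s = 1"
    unfolding s_def by (simp add: fls_inverse_subdegree)
  show "fps_to_fls (fls_regpart s) = s"
    using sub by simp
qed

lemma affine_subst_X_inv:
  fixes \<alpha> \<beta> :: "'a::field"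
  assumes "\<alpha> \<noteq> 0"
  shows "affine_subst \<alpha> \<beta> fls_X_inv = fls_const \<alpha> * fls_X_inv + fls_const \<beta>"
proof -
  let ?s = "inverse (fls_const \<alpha> * fls_X_inv + fls_const \<beta>)"
  have "fls_regpart ?s \<noteq> 0"
    using subst_series[OF assms, of \<beta>] by (metis fls_zero_subdegree fps_zero_to_fls zero_neq_one)
  have "affine_subst \<alpha> \<beta> (fls_shift 1 1) = 1 * fps_to_fls (fls_regpart ?s) powi (-1)"
    unfolding affine_subst_def
    by (subst fls_compose_fps_shift) (use \<open>fls_regpart ?s \<noteq> 0\<close> in simp_all)
  then show ?thesis
    using subst_series(1)[OF assms, of \<beta>]
    by (simp add: power_int_minus fls_X_inv_conv_shift_1)
qed

end

theory Submission
  imports Defs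
begin

text \<open>Write \<open>R\<close> for \<^const>\<open>F_minus\<close>, the ring \<open>\<F>\<^sub>q[t\<^sup>-\<^sup>1]\<close>, and
\<open>D(x, y) = x\<^sup>r y - x y\<^sup>r\<close>.  The commutator of two elements of \<open>G\<^sub>2\<close> with coordinates \<open>(x, z)\<close> and
\<open>(y, w)\<close> is the central element with coordinates \<open>(0, D(x, y))\<close>.  After passing to subgroups of finite
index one may assume that \<open>\<lambda>\<close> is an isomorphism between subgroups of finite index in \<open>G\<^sub>2(R)\<close>.  It
respects centres, so on the first coordinate it induces an additive bijection \<open>f\<close> between two subgroups
\<open>V\<close> and \<open>W\<close> of finite index in \<open>R\<close>, and \<open>D(x, y) = D(x', y')\<close> holds if and only if
\<open>D(f x, f y) = D(f x', f y')\<close>.  The theorem reduces to showing that \<open>f x = a \<tau> x\<close> with a ring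
automorphism \<open>\<tau>\<close> of \<open>R\<close>: the difference between \<open>\<lambda>\<close> and \<open>\<phi>\<^sub>\<tau>\<^sub>,\<^sub>a\<close> is then central and
therefore a homomorphism.

The determination of \<open>f\<close> has three steps.

Lines.  For nonzero \<open>x, x'\<close> in \<open>V\<close> the equation \<open>D(x, y) = D(x', y')\<close> has infinitely many solutions
\<open>(y, y')\<close> in \<open>V\<close> exactly when \<open>x / x'\<close> is an \<open>r\<close>-th power in \<open>F\<close>.  If \<open>x / x'\<close> is not an
\<open>r\<close>-th power, the additive form \<open>x y\<^sup>r - x' y'\<^sup>r\<close> is anisotropic, hence its degree grows like \<open>r\<close>
times the degree of its arguments, faster than that of \<open>x\<^sup>r y - x'\<^sup>r y'\<close> (\<open>finite_comm_eq\<close>); if it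
is one, the solutions can be written down (\<open>comm_eq_solution\<close>).  Hence \<open>f\<close> maps lines of the vector
space \<open>F\<close> over the subfield \<open>F\<^sup>r\<close> to lines, and the argument of the fundamental theorem of projective
geometry yields a ring homomorphism \<open>\<tau>\<close> with \<open>f (l\<^sup>r x) = (\<tau> l)\<^sup>r f x\<close> (\<open>semilinear_factor\<close>).

Linearity.  Extend \<open>f\<close> semilinearly to \<open>R\<close>.  The explicit solutions for \<open>x / x' = d\<^sup>r\<close> depend on a
parameter \<open>u\<close>; applying \<open>f\<close> to them gives a polynomial identity in \<open>(\<tau> u)\<^sup>r\<close> for infinitely many values.
Its leading coefficient must vanish, and this says \<open>f (d x) = \<tau> d \<cdot> f x\<close> (\<open>extension_mult\<close>).  Hence
\<open>f x = f 1 \<cdot> \<tau> x\<close>.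

Integrality.  Since \<open>V\<close> and \<open>W\<close> have finite index in \<open>R\<close>, all powers of \<open>c = \<tau> l\<close> have a common
denominator in \<open>R\<close>.  The ideal of common denominators is principal and stable under \<open>c\<close>, so \<open>c\<close> lies
in \<open>R\<close> (\<open>factor_F_minus\<close>).  The same reasoning for the inverse of \<open>f\<close> shows \<open>\<tau> R = R\<close>.  A ring
automorphism of the polynomial ring \<open>R\<close> is given by an automorphism of \<open>\<F>\<^sub>q\<close> and an affine
substitution, and both extend to \<open>F\<close> (\<open>extends_to_standard\<close>).\<close>

notation fls_nth (infixl "$$" 75)

section \<open>Laurent series and the subring of polynomials in the inverse variable\<close>

definition fls_restrict :: "int set \<Rightarrow> 'a::zero fls \<Rightarrow> 'a fls" where
  "fls_restrict S f = Abs_fls (\<lambda>n. if n \<in> S then f $$ n else 0)"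

lemma fls_restrict_nth [simp]: "fls_restrict S f $$ n = (if n \<in> S then f $$ n else 0)"
  unfolding fls_restrict_def
  by (rule nth_Abs_fls_lower_bound[of "fls_subdegree f"]) auto

lemma F_minus_iff: "f \<in> F_minus \<longleftrightarrow> (\<forall>n>0. f $$ n = 0)"
  for f :: "'a::field fls"
proof -
  have nth: "poly (map_poly fls_const P) fls_X_inv $$ n = (if n \<le> 0 then coeff P (nat (- n)) else 0)"
    for P :: "'a poly" and n
  proof (induction P arbitrary: n)
    case (pCons a P)
    have "poly (map_poly fls_const (pCons a P)) fls_X_inv =
        fls_const a + fls_X_inv * poly (map_poly fls_const P) fls_X_inv"
      by (subst map_poly_pCons) (use pCons.hyps in auto)
    moreover have "nat (- n) = Suc (nat (- n - 1))" if "n < 0" using that by simp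
    ultimately show ?case
      using pCons.IH[of "n + 1"] by (auto simp: fls_X_inv_times_conv_shift coeff_pCons split: nat.split)
  qed auto
  show ?thesis
  proof
    assume R: "\<forall>n>0. f $$ n = 0"
    define P where "P = (\<Sum>i\<le>nat (- fls_subdegree f). monom (f $$ (- int i)) i)"
    have "coeff P j = f $$ (- int j)" for j
    proof (cases "j \<le> nat (- fls_subdegree f)")
      case False
      then have "f $$ (- int j) = 0" by (intro fls_eq0_below_subdegree) linarith
      with False show ?thesis by (simp add: P_def coeff_sum)
    qed (simp add: P_def coeff_sum)
    then have "poly (map_poly fls_const P) fls_X_inv = f"
      using R by (intro fls_eqI) (simp add: nth)
    then show "f \<in> F_minus" unfolding F_minus_def by blast
  qed (auto simp: F_minus_def nth)
qed

lemma F_minus_nth: "f \<in> F_minus \<Longrightarrow> n > 0 \<Longrightarrow> f $$ n = 0"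
  by (simp add: F_minus_iff)

lemma F_minus_0 [simp]: "0 \<in> F_minus" and F_minus_1 [simp]: "1 \<in> F_minus"
  and F_minus_const [simp]: "fls_const c \<in> F_minus" and F_minus_X_inv [simp]: "fls_X_inv \<in> F_minus"
  by (auto simp: F_minus_iff)

lemma F_minus_add: "f \<in> F_minus \<Longrightarrow> g \<in> F_minus \<Longrightarrow> f + g \<in> F_minus"
  and F_minus_uminus: "f \<in> F_minus \<Longrightarrow> - f \<in> F_minus"
  and F_minus_diff: "f \<in> F_minus \<Longrightarrow> g \<in> F_minus \<Longrightarrow> f - g \<in> F_minus"
  by (auto simp: F_minus_iff)

lemma F_minus_mult:
  assumes "f \<in> F_minus" "g \<in> F_minus"
  shows "f * g \<in> F_minus"
  unfolding F_minus_iff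
proof (intro allI impI)
  fix n :: int assume "n > 0"
  show "(f * g) $$ n = 0"
    unfolding fls_times_nth(2)
  proof (rule sum.neutral, rule ballI)
    fix i
    show "f $$ i * g $$ (n - i) = 0"
      using F_minus_nth[OF assms(1), of i] F_minus_nth[OF assms(2), of "n - i"] \<open>n > 0\<close>
      by (cases "i > 0") auto
  qed
qed

lemma F_minus_power: "f \<in> F_minus \<Longrightarrow> f ^ n \<in> F_minus"
  by (induction n) (auto intro: F_minus_mult)

lemmas F_minus_closed = F_minus_add F_minus_uminus F_minus_diff F_minus_mult F_minus_power

lemma F_minus_subdegree: "f \<in> F_minus \<Longrightarrow> fls_subdegree f \<le> 0"
  by (metis F_minus_nth fls_zero_subdegree nth_fls_subdegree_zero_iff linorder_not_le order_refl)

text \<open>Horner's scheme as an induction rule.  The inductive step has a nonzero \<open>g\<close>, so that the degree of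
\<open>c + t\<^sup>-\<^sup>1 g\<close> exceeds the degree of \<open>g\<close> by exactly one.\<close>

lemma F_minus_induct [consumes 1, case_names const X_inv]:
  fixes f :: "'a::field fls"
  assumes "f \<in> F_minus" and const: "\<And>c. P (fls_const c)"
    and step: "\<And>c g. g \<in> F_minus \<Longrightarrow> g \<noteq> 0 \<Longrightarrow> P g \<Longrightarrow> P (fls_const c + fls_X_inv * g)"
  shows "P f"
  using assms(1)
proof (induction "nat (- fls_subdegree f)" arbitrary: f rule: less_induct)
  case less
  \<comment> \<open>Multiplication by \<open>t\<close> lowers the degree, once the constant term has been removed.\<close>
  define g where "g = fls_X * (f - fls_const (f $$ 0))"
  have f: "f = fls_const (f $$ 0) + fls_X_inv * g"
    by (simp add: g_def fls_X_inv_conv_shift_1 fls_X_times_conv_shift fls_shifted_times_simps)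
  show ?case
  proof (cases "g = 0")
    case True
    then show ?thesis using f const[of "f $$ 0"] by simp
  next
    case False
    have nth: "g $$ n = (if n = 1 then 0 else f $$ (n - 1))" for n
      by (simp add: g_def fls_X_times_conv_shift)
    have g: "g \<in> F_minus"
      using less.prems by (simp add: F_minus_iff nth)
    have le: "fls_subdegree g \<le> 0" by (rule F_minus_subdegree[OF g])
    have "g $$ fls_subdegree g \<noteq> 0" using False by simp
    then have "f $$ (fls_subdegree g - 1) \<noteq> 0" by (metis nth)
    then have "fls_subdegree f \<le> fls_subdegree g - 1" by (rule fls_subdegree_leI)
    with le have "nat (- fls_subdegree g) < nat (- fls_subdegree f)" by linarith
    from less.hyps[OF this g] False g step f show ?thesis by metis
  qed
qed

lemma finite_F_minus_bounded:
  "finite {f \<in> (F_minus :: 'a::{field,finite} fls set). f = 0 \<or> fls_subdegree f \<ge> N}" (is "finite ?A")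
proof -
  have "inj_on (\<lambda>f. \<lambda>n\<in>{N..0}. f $$ n) ?A"
  proof (rule inj_onI, rule fls_eqI)
    fix f g n assume f: "f \<in> ?A" and g: "g \<in> ?A"
      and eq: "(\<lambda>n\<in>{N..0}. f $$ n) = (\<lambda>n\<in>{N..0}. g $$ n)"
    consider "n \<in> {N..0}" | "n < N" | "n > 0" by force
    then show "f $$ n = g $$ n"
    proof cases
      case 1 with fun_cong[OF eq, of n] show ?thesis by simp
    next
      case 2 with f g show ?thesis by auto
    next
      case 3 with f g show ?thesis by (simp add: F_minus_nth)
    qed
  qed
  moreover have "(\<lambda>f. \<lambda>n\<in>{N..0}. f $$ n) ` ?A \<subseteq> {N..0} \<rightarrow>\<^sub>E UNIV" by auto
  moreover have "finite ({N..0::int} \<rightarrow>\<^sub>E (UNIV::'a set))" by (intro finite_PiE) auto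
  ultimately show ?thesis by (meson finite_subset finite_imageD)
qed

lemma infinite_F_minus: "infinite (F_minus :: 'a::field fls set)"
proof
  assume fin: "finite (F_minus :: 'a fls set)"
  have "inj (\<lambda>n::nat. (fls_X_inv :: 'a fls) ^ n)"
    by (rule injI) (metis fls_subdegree_fls_X_inv_pow neg_equal_iff_equal of_nat_eq_iff)
  moreover have "range (\<lambda>n::nat. (fls_X_inv :: 'a fls) ^ n) \<subseteq> F_minus"
    by (auto intro: F_minus_power)
  ultimately show False using fin by (meson finite_imageD finite_subset infinite_UNIV_nat)
qed

text \<open>Division with remainder in \<open>\<F>\<^sub>q[t\<^sup>-\<^sup>1]\<close>.  The degree of a polynomial in \<open>t\<^sup>-\<^sup>1\<close> is the negative of its
subdegree as a Laurent series, so a larger subdegree means a smaller remainder.  The quotient is the part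
of the Laurent series \<open>f / m\<close> with exponents at most zero.\<close>

lemma F_minus_division:
  fixes f m :: "'a::field fls"
  assumes "f \<in> F_minus" "m \<in> F_minus" "m \<noteq> 0"
  obtains q where "q \<in> F_minus" "f - q * m = 0 \<or> fls_subdegree (f - q * m) > fls_subdegree m"
proof
  let ?q = "fls_restrict {..0} (f / m)" and ?e = "fls_restrict {0<..} (f / m)"
  show "?q \<in> F_minus" by (simp add: F_minus_iff)
  have "f / m = ?q + ?e" by (intro fls_eqI) auto
  then have "f = (?q + ?e) * m" using assms(3) by (simp add: nonzero_divide_eq_eq)
  then have e: "f - ?q * m = ?e * m" by (simp add: algebra_simps)
  have "fls_subdegree ?e > 0" if "?e \<noteq> 0"
    by (rule fls_subdegree_greaterI[OF that]) simp
  then show "f - ?q * m = 0 \<or> fls_subdegree (f - ?q * m) > fls_subdegree m"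
    unfolding e using assms(3) by (cases "?e = 0") auto
qed

text \<open>The residue ring modulo a nonzero \<open>m\<close> is finite, phrased by a finite colouring whose colours are the
remainders of the division by \<open>m\<close>.\<close>

lemma finite_colouring_mod:
  fixes m :: "'a::{field,finite} fls"
  assumes "m \<in> F_minus" "m \<noteq> 0"
  obtains c :: "'a fls \<Rightarrow> 'a fls" where "finite (c ` F_minus)"
    "\<And>f g. f \<in> F_minus \<Longrightarrow> g \<in> F_minus \<Longrightarrow> c f = c g \<Longrightarrow> \<exists>h\<in>F_minus. f - g = m * h"
proof -
  have "\<forall>f\<in>F_minus. \<exists>q\<in>F_minus. f - q * m = 0 \<or> fls_subdegree (f - q * m) > fls_subdegree m"
    using F_minus_division assms by metis
  then obtain q where q: "\<And>f. f \<in> F_minus \<Longrightarrow> q f \<in> F_minus"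
    "\<And>f. f \<in> F_minus \<Longrightarrow> f - q f * m = 0 \<or> fls_subdegree (f - q f * m) > fls_subdegree m"
    by metis
  show thesis
  proof
    have "(\<lambda>f. f - q f * m) ` F_minus \<subseteq> {f \<in> F_minus. f = 0 \<or> fls_subdegree f \<ge> fls_subdegree m}"
    proof
      fix g assume "g \<in> (\<lambda>f. f - q f * m) ` F_minus"
      then obtain f where f: "f \<in> F_minus" "g = f - q f * m" by blast
      with q(2)[OF f(1)] q(1)[OF f(1)] assms(1)
      show "g \<in> {f \<in> F_minus. f = 0 \<or> fls_subdegree f \<ge> fls_subdegree m}"
        by (auto intro!: F_minus_closed)
    qed
    then show "finite ((\<lambda>f. f - q f * m) ` F_minus)"
      by (rule finite_subset[OF _ finite_F_minus_bounded])
    fix f g assume "f \<in> F_minus" "g \<in> F_minus" "f - q f * m = g - q g * m"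
    then show "\<exists>h\<in>F_minus. f - g = m * h"
      by (intro bexI[of _ "q f - q g"]) (auto simp: algebra_simps q F_minus_diff)
  qed
qed

lemma fls_subdegree_mono: "(\<And>n. g $$ n \<noteq> 0 \<Longrightarrow> f $$ n \<noteq> 0) \<Longrightarrow> g \<noteq> 0 \<Longrightarrow> fls_subdegree f \<le> fls_subdegree g"
  by (meson fls_subdegree_leI nth_fls_subdegree_nonzero)

section \<open>The Frobenius power map\<close>

text \<open>The power \<open>r\<close> of the characteristic is fixed.  The parameter \<open>field_type\<close> only names the coefficient
field, which does not occur in the types of \<open>r\<close> and \<open>k\<close>.\<close>

locale frobenius_power =
  fixes r k :: nat and field_type :: "'a::{field,finite} itself"
  assumes r_power: "r = CHAR('a) ^ k" and r_gt_1: "r > 1"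
begin

lemma prime_CHAR: "prime CHAR('a)"
  by (rule prime_CHAR_semidom) (rule finite_imp_CHAR_pos, simp)

lemma r_pos: "r > 0" using r_gt_1 by simp

lemma frobenius_add: "(x + y) ^ r = x ^ r + y ^ r" for x y :: "'a fls"
  by (rule freshmans_dream'[of _ k]) (use prime_CHAR r_power in auto)

lemma frobenius_diff: "(x - y) ^ r = x ^ r - y ^ r" for x y :: "'a fls"
  using frobenius_add[of "x - y" y] by simp

lemma frobenius_sum: "sum f A ^ r = (\<Sum>i\<in>A. f i ^ r)" for f :: "'b \<Rightarrow> 'a fls"
  by (rule freshmans_dream_sum'[where n = k]) (use prime_CHAR r_power in auto)

lemma frobenius_inj: "x ^ r = y ^ r \<longleftrightarrow> x = y" for x y :: "'a fls"
  using frobenius_diff[of x y] r_pos by (metis right_minus_eq zero_power power_not_zero)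

lemma frobenius_surj_const: "\<exists>c. c ^ r = a" for a :: 'a
proof -
  have "inj (\<lambda>c::'a. c ^ r)"
  proof (rule injI)
    fix x y :: 'a assume "x ^ r = y ^ r"
    then have "fls_const x ^ r = fls_const y ^ r" by (simp flip: fls_const_power)
    then show "x = y" by (metis frobenius_inj fls_const_nonzero right_minus_eq fls_const_0 fls_minus_const)
  qed
  then have "surj (\<lambda>c::'a. c ^ r)" by (simp add: finite_UNIV_inj_surj)
  then show ?thesis by (metis surjD)
qed

text \<open>Only finitely many coefficients of \<open>f\<close> influence a given coefficient of \<open>f\<^sup>r\<close>; on finite sums of
monomials the formula is additivity of \<open>x \<mapsto> x\<^sup>r\<close>.\<close>

lemma frobenius_nth:
  fixes f :: "'a fls"
  shows "(f ^ r) $$ n = (if int r dvd n then (f $$ (n div int r)) ^ r else 0)"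
proof -
  let ?I = "{fls_subdegree f..\<bar>n\<bar>}"
  define g where "g = (\<Sum>i\<in>?I. fls_const (f $$ i) * fls_X_intpow i)"
  define h where "h = f - g"
  have gnth: "g $$ j = (if j \<in> ?I then f $$ j else 0)" for j
  proof -
    have "g $$ j = (\<Sum>i\<in>?I. if i = j then f $$ i else 0)"
      unfolding g_def fls_nth_sum by (rule sum.cong) auto
    then show ?thesis by simp
  qed
  have "h $$ j = 0" if "j \<le> \<bar>n\<bar>" for j
    using that by (auto simp: h_def gnth)
  then have "fls_subdegree h > \<bar>n\<bar>" if "h \<noteq> 0" 
    using fls_subdegree_greaterI[OF that, of "\<bar>n\<bar>"] by blast
  then have "int r * fls_subdegree h > n" if "h \<noteq> 0"
    using that r_gt_1 by (smt (verit, best) mult_less_cancel_right2 of_nat_1 of_nat_less_iff)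
  then have "(h ^ r) $$ n = 0"
    by (cases "h = 0") (use r_pos in \<open>auto simp: fls_subdegree_pow zero_power\<close>)
  then have "(f ^ r) $$ n = (g ^ r) $$ n"
    using frobenius_add[of g h] by (simp add: h_def)
  also have "\<dots> = (\<Sum>i\<in>?I. (fls_const ((f $$ i) ^ r) * fls_X_intpow (int r * i)) $$ n)"
    unfolding g_def frobenius_sum fls_nth_sum
    by (simp add: power_mult_distrib fls_X_intpow_power flip: fls_const_power)
  also have "\<dots> = (\<Sum>i\<in>?I. if int r dvd n \<and> i = n div int r then (f $$ i) ^ r else 0)"
    by (rule sum.cong) (use r_pos in auto)
  also have "\<dots> = (if int r dvd n then (f $$ (n div int r)) ^ r else 0)"
  proof (cases "int r dvd n")
    case True
    then obtain j where j: "n = int r * j" by blast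
    have "1 * \<bar>j\<bar> \<le> int r * \<bar>j\<bar>" by (rule mult_right_mono) (use r_pos in auto)
    then have "j \<le> \<bar>n\<bar>" by (simp add: j abs_mult)
    then have "f $$ j = 0" if "j \<notin> ?I" using that by simp
    moreover have "n div int r = j" using j r_pos by simp
    ultimately show ?thesis using True r_pos by (cases "j \<in> ?I") (simp_all add: zero_power)
  qed simp
  finally show ?thesis .
qed

lemma F_minus_root: "x ^ r \<in> F_minus \<Longrightarrow> x \<in> F_minus" for x :: "'a fls"
  unfolding F_minus_iff
proof (intro allI impI)
  fix n :: int assume x: "\<forall>n>0. (x ^ r) $$ n = 0" and "n > 0"
  then have "(x ^ r) $$ (int r * n) = 0" using r_pos by simp
  then show "x $$ n = 0" using r_pos by (simp add: frobenius_nth)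
qed

text \<open>The finite field of coefficients is perfect, so the subfield \<open>F\<^sup>r\<close> consists of all series in \<open>t\<^sup>r\<close>.\<close>

lemma frobenius_range_iff:
  fixes f :: "'a fls"
  shows "(\<exists>g. f = g ^ r) \<longleftrightarrow> (\<forall>n. \<not> int r dvd n \<longrightarrow> f $$ n = 0)"
proof
  assume supp: "\<forall>n. \<not> int r dvd n \<longrightarrow> f $$ n = 0"
  obtain R where R: "\<And>a::'a. R a ^ r = a" using frobenius_surj_const by metis
  define g where "g = Abs_fls (\<lambda>n. R (f $$ (int r * n)))"
  have R0: "R 0 = 0" using R[of 0] r_pos by simp
  have "g $$ n = R (f $$ (int r * n))" for n
    unfolding g_def
  proof (rule nth_Abs_fls_lower_bound[of "- \<bar>fls_subdegree f\<bar>"], intro allI impI)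
    fix n assume "n < - \<bar>fls_subdegree f\<bar>"
    then have "int r * n < fls_subdegree f" using r_gt_1 
      by (smt (verit, best) mult_less_cancel_right2 of_nat_1 of_nat_less_iff)
    then show "R (f $$ (int r * n)) = 0" by (simp add: R0)
  qed
  then have "f = g ^ r" using supp R by (intro fls_eqI) (auto simp: frobenius_nth)
  then show "\<exists>g. f = g ^ r" ..
qed (auto simp: frobenius_nth)

lemma mult_power_off_multiples:
  fixes f g :: "'a fls"
  assumes n: "\<And>n. int r dvd n \<Longrightarrow> f $$ n = 0" and "int r dvd m"
  shows "(f * g ^ r) $$ m = 0"
  unfolding fls_times_nth(2)
proof (rule sum.neutral, rule ballI)
  fix i
  have "int r dvd m \<Longrightarrow> int r dvd m - i \<Longrightarrow> int r dvd i" by (metis dvd_diff_right_iff dvd_diff_commute diff_diff_eq2 add_diff_cancel_left' dvd_diff)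
  then show "f $$ i * (g ^ r) $$ (m - i) = 0"
    using assms by (auto simp: frobenius_nth)
qed

text \<open>The form \<open>x y\<^sup>r - x' y'\<^sup>r\<close> is anisotropic when \<open>x / x'\<close> is not an \<open>r\<close>-th power.  Quantitatively,
split \<open>x / x' = w\<^sup>r + v\<close>, where \<open>v \<noteq> 0\<close> collects the exponents that are not divisible by \<open>r\<close>.  Then
\<open>(x / x') y\<^sup>r - y'\<^sup>r = (w y - y')\<^sup>r + v y\<^sup>r\<close>, and the two summands have disjoint supports, so \<open>y'\<close>
cannot cancel the leading term of \<open>v y\<^sup>r\<close>.\<close>

lemma subdegree_non_power_le:
  fixes x x' :: "'a fls"
  assumes "x \<noteq> 0" "x' \<noteq> 0" and np: "\<nexists>c. x = c ^ r * x'"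
  shows "\<exists>C. \<forall>y y'. y \<noteq> 0 \<longrightarrow> x * y ^ r - x' * y' ^ r \<noteq> 0 \<and>
           fls_subdegree (x * y ^ r - x' * y' ^ r) \<le> C + int r * fls_subdegree y"
proof -
  define M where "M = {n. int r dvd n}"
  define f where "f = x / x'"
  define u where "u = fls_restrict M f"
  define v where "v = fls_restrict (- M) f"
  have uv: "f = u + v" by (intro fls_eqI) (auto simp: u_def v_def)
  obtain w where w: "u = w ^ r" using frobenius_range_iff[of u] by (auto simp: u_def M_def)
  have "v \<noteq> 0"
  proof
    assume "v = 0"
    then have "x = w ^ r * x'" using uv w assms(2) by (simp add: f_def field_simps)
    with np show False by blast
  qed
  have "x * y ^ r - x' * y' ^ r \<noteq> 0 \<and>
     fls_subdegree (x * y ^ r - x' * y' ^ r) \<le> fls_subdegree x' + fls_subdegree v + int r * fls_subdegree y"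
    if "y \<noteq> 0" for y y'
  proof -
    define D where "D = f * y ^ r - y' ^ r"
    have D: "D = (w * y - y') ^ r + v * y ^ r"
      by (simp add: D_def uv w frobenius_diff power_mult_distrib algebra_simps)
    have vy: "v * y ^ r \<noteq> 0" using \<open>v \<noteq> 0\<close> \<open>y \<noteq> 0\<close> by simp
    have Dn: "D $$ n = (v * y ^ r) $$ n" if "\<not> int r dvd n" for n
      using that by (simp add: D frobenius_nth)
    have vyn: "(v * y ^ r) $$ n = 0" if "int r dvd n" for n
      by (rule mult_power_off_multiples) (auto simp: v_def M_def that)
    have le: "fls_subdegree D \<le> fls_subdegree (v * y ^ r)"
      by (rule fls_subdegree_mono[OF _ vy]) (use Dn vyn in metis)
    have D0: "D \<noteq> 0" using Dn vyn vy by (metis fls_zero_nth fls_eqI)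
    have eq: "x * y ^ r - x' * y' ^ r = x' * D" using assms by (simp add: D_def f_def field_simps)
    show ?thesis
      unfolding eq using le D0 assms \<open>v \<noteq> 0\<close> \<open>y \<noteq> 0\<close> by (simp add: fls_subdegree_pow)
  qed
  then show ?thesis by blast
qed


end

section \<open>Subgroups of finite index and the commutator form\<close>

lemma finite_colouring_nat:
  fixes c :: "'b \<Rightarrow> 'c"
  assumes "finite (c ` K)"
  obtains d :: "'b \<Rightarrow> nat" where "finite (d ` K)" "\<And>x y. x \<in> K \<Longrightarrow> y \<in> K \<Longrightarrow> d x = d y \<Longrightarrow> c x = c y"
proof
  let ?n = "to_nat_on (c ` K)"
  show "finite ((\<lambda>x. ?n (c x)) ` K)"
    using finite_imageI[OF assms, of ?n] by (simp add: image_image)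
  have "inj_on ?n (c ` K)" by (rule inj_on_to_nat_on) (rule countable_finite[OF assms])
  then show "c x = c y" if "x \<in> K" "y \<in> K" "?n (c x) = ?n (c y)" for x y
    using that by (meson imageI inj_onD)
qed

text \<open>Additive subgroups of finite index in \<open>\<F>\<^sub>q[t\<^sup>-\<^sup>1]\<close>.  Finiteness of the index is expressed by a finite
colouring that separates the cosets, because colourings pull back along additive maps and can be combined
by forming pairs.\<close>

definition finite_coindex :: "'a::field fls set \<Rightarrow> bool" where
  "finite_coindex V \<longleftrightarrow> V \<subseteq> F_minus \<and> (\<forall>x\<in>V. \<forall>y\<in>V. x - y \<in> V) \<and>
     (\<exists>c :: 'a fls \<Rightarrow> nat. finite (c ` F_minus) \<and>
        (\<forall>x\<in>F_minus. \<forall>y\<in>F_minus. c x = c y \<longrightarrow> x - y \<in> V))"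

lemma finite_coindexI:
  fixes c :: "'a::field fls \<Rightarrow> 'b"
  assumes "V \<subseteq> F_minus" "\<And>x y. x \<in> V \<Longrightarrow> y \<in> V \<Longrightarrow> x - y \<in> V" "finite (c ` F_minus)"
    "\<And>x y. x \<in> F_minus \<Longrightarrow> y \<in> F_minus \<Longrightarrow> c x = c y \<Longrightarrow> x - y \<in> V"
  shows "finite_coindex V"
proof -
  obtain d :: "'a fls \<Rightarrow> nat" where "finite (d ` F_minus)"
    "\<And>x y. x \<in> F_minus \<Longrightarrow> y \<in> F_minus \<Longrightarrow> d x = d y \<Longrightarrow> c x = c y"
    using finite_colouring_nat[OF assms(3)] by metis
  with assms(1,2,4) show ?thesis unfolding finite_coindex_def by blast
qed

lemma finite_coindex_subset: "finite_coindex V \<Longrightarrow> x \<in> V \<Longrightarrow> x \<in> F_minus"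
  and finite_coindex_diff: "finite_coindex V \<Longrightarrow> x \<in> V \<Longrightarrow> y \<in> V \<Longrightarrow> x - y \<in> V"
  and finite_coindex_0: "finite_coindex V \<Longrightarrow> 0 \<in> V"
  unfolding finite_coindex_def by (blast, blast, metis F_minus_0 diff_self)

lemma finite_coindex_add:
  assumes "finite_coindex V" "x \<in> V" "y \<in> V"
  shows "x + y \<in> V"
proof -
  have "0 - y \<in> V" by (intro finite_coindex_diff finite_coindex_0 assms)
  from finite_coindex_diff[OF assms(1,2) this] show ?thesis by simp
qed

text \<open>By pigeonhole, infinitely many elements of \<open>\<F>\<^sub>q[t\<^sup>-\<^sup>1]\<close> have the same colours under all the maps in \<open>A\<close>;
their differences lie in the common preimage.\<close>

lemma finite_coindex_common_preimage:
  fixes V :: "'a::field fls set"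
  assumes V: "finite_coindex V" and "finite A"
    and closed: "\<And>h x. h \<in> A \<Longrightarrow> x \<in> F_minus \<Longrightarrow> h x \<in> F_minus"
    and diff: "\<And>h x y. h \<in> A \<Longrightarrow> x \<in> F_minus \<Longrightarrow> y \<in> F_minus \<Longrightarrow> h (x - y) = h x - h y"
  shows "infinite {x \<in> F_minus. \<forall>h\<in>A. h x \<in> V}"
proof
  assume fin: "finite {x \<in> F_minus. \<forall>h\<in>A. h x \<in> V}" (is "finite ?K")
  obtain c :: "'a fls \<Rightarrow> nat" where c: "finite (c ` F_minus)"
    "\<And>x y. x \<in> F_minus \<Longrightarrow> y \<in> F_minus \<Longrightarrow> c x = c y \<Longrightarrow> x - y \<in> V"
    using V unfolding finite_coindex_def by blast
  define C where "C x = (\<lambda>h\<in>A. c (h x))" for x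
  have "C ` F_minus \<subseteq> A \<rightarrow>\<^sub>E c ` F_minus" by (auto simp: C_def closed)
  then have "finite (C ` F_minus)"
    by (rule finite_subset) (intro finite_PiE \<open>finite A\<close> c)
  then obtain x0 where x0: "x0 \<in> F_minus" "infinite {x \<in> F_minus. C x = C x0}"
    using pigeonhole_infinite[OF infinite_F_minus, of C] by blast
  have "(\<lambda>x. x - x0) ` {x \<in> F_minus. C x = C x0} \<subseteq> ?K"
  proof clarify
    fix x assume x: "x \<in> F_minus" "C x = C x0"
    have "h (x - x0) \<in> V" if "h \<in> A" for h
      using that fun_cong[OF x(2), of h] x0 x by (auto simp: C_def diff closed intro!: c(2))
    with x x0 show "x - x0 \<in> F_minus \<and> (\<forall>h\<in>A. h (x - x0) \<in> V)" by (simp add: F_minus_diff)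
  qed
  then have "finite ((\<lambda>x. x - x0) ` {x \<in> F_minus. C x = C x0})" by (rule finite_subset[OF _ fin])
  with x0(2) show False by (auto dest!: finite_imageD simp: inj_on_def)
qed

text \<open>A subgroup of finite index need not contain a nonzero ideal; this weaker substitute handles finitely many
multipliers at a time.\<close>

lemma finite_coindex_multiplier:
  fixes V :: "'a::field fls set"
  assumes "finite_coindex V" "finite A" "A \<subseteq> F_minus"
  obtains x where "x \<in> V" "x \<noteq> 0" "\<And>a. a \<in> A \<Longrightarrow> a * x \<in> V"
proof -
  have "infinite {x \<in> F_minus. \<forall>h\<in>(*) ` insert 1 A. h x \<in> V}"
    by (rule finite_coindex_common_preimage) (use assms in \<open>auto simp: algebra_simps intro: F_minus_mult\<close>)
  then obtain x where "x \<in> {x \<in> F_minus. \<forall>h\<in>(*) ` insert 1 A. h x \<in> V} - {0}"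
    by (metis (no_types, lifting) finite.emptyI infinite_remove ex_in_conv)
  then show thesis by (intro that[of x]) auto
qed

text \<open>The second coordinate of the commutator of two elements of \<open>G\<^sub>2\<close> whose first coordinates are \<open>x\<close> and \<open>y\<close>;
see \<open>commutator_eq\<close> below.\<close>

definition commutator_form :: "nat \<Rightarrow> 'b::comm_ring_1 \<Rightarrow> 'b \<Rightarrow> 'b" where
  "commutator_form r x y = x ^ r * y - x * y ^ r"

lemma comm_mult: "commutator_form r (c * x) (c * y) = c ^ (r + 1) * commutator_form r x y"
  by (simp add: commutator_form_def power_mult_distrib algebra_simps)

context frobenius_power
begin

lemma frobenius_uminus: "(- x) ^ r = - (x ^ r)" for x :: "'a fls"
  using frobenius_diff[of 0 x] r_pos by (simp add: zero_power)

lemma comm_eq_iff: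
  fixes e d y y' :: "'a fls"
  assumes "e \<noteq> 0"
  shows "commutator_form r (d ^ r * e) y = commutator_form r e y' \<longleftrightarrow>
    (d * y - y') ^ r = e ^ (r - 1) * ((d ^ r) ^ r * y - y')"
proof -
  have e: "e ^ r = e * e ^ (r - 1)" using r_pos by (metis power_minus_mult mult.commute)
  have "commutator_form r (d ^ r * e) y - commutator_form r e y' =
    e * (e ^ (r - 1) * ((d ^ r) ^ r * y - y') - (d * y - y') ^ r)"
    unfolding commutator_form_def by (simp add: power_mult_distrib e frobenius_diff algebra_simps)
  then show ?thesis using assms by (metis (no_types, lifting) mult_eq_0_iff right_minus_eq)
qed

text \<open>Putting \<open>w = d y - y'\<close> in \<open>comm_eq_iff\<close> makes \<open>w\<close> a free parameter: the equation is linear in \<open>y\<close>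
once \<open>w\<close> is given.  Choosing \<open>w = v N\<close> removes the denominator \<open>N\<close>, so that the solution is
polynomial in \<open>v\<close>.\<close>

lemma comm_eq_solution:
  fixes e d v :: "'a fls"
  assumes "e \<noteq> 0"
  defines "N \<equiv> e ^ (r - 1) * ((d ^ r) ^ r - d)"
  shows "commutator_form r (d ^ r * e) (v ^ r * N ^ (r - 1) - v * e ^ (r - 1)) =
     commutator_form r e (v ^ r * (d * N ^ (r - 1)) - v * (e ^ (r - 1) * (d ^ r) ^ r))"
proof (subst comm_eq_iff[OF assms(1)])
  define y where "y = v ^ r * N ^ (r - 1) - v * e ^ (r - 1)"
  define y' where "y' = v ^ r * (d * N ^ (r - 1)) - v * (e ^ (r - 1) * (d ^ r) ^ r)"
  have "d * y - y' = v * N" by (simp add: y_def y'_def N_def algebra_simps)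
  moreover have "e ^ (r - 1) * ((d ^ r) ^ r * y - y') = N * (v ^ r * N ^ (r - 1))"
    by (simp add: y_def y'_def N_def algebra_simps)
  moreover have "N ^ r = N * N ^ (r - 1)" using r_pos by (metis power_minus_mult mult.commute)
  ultimately show "(d * y - y') ^ r = e ^ (r - 1) * ((d ^ r) ^ r * y - y')"
    by (simp add: power_mult_distrib algebra_simps)
qed

text \<open>The parametrised solutions are additive in the parameter, so infinitely many of them lie in a subgroup
of finite index.  The ratio \<open>c\<close> need not be a polynomial; its denominator divides \<open>x'\<close>, and taking
\<open>v\<close> divisible by \<open>M = x'\<^bsup>r*r\<^esup>\<close> keeps all terms integral.\<close>

lemma infinite_comm_eq:
  fixes V :: "'a fls set"
  assumes V: "finite_coindex V" and x: "x \<in> F_minus" "x \<noteq> 0" and x': "x' \<in> F_minus" "x' \<noteq> 0"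
    and c: "x = c ^ r * x'"
  shows "infinite {(y, y'). y \<in> V \<and> y' \<in> V \<and> commutator_form r x y = commutator_form r x' y'}"
proof -
  define N where "N = x' ^ (r - 1) * ((c ^ r) ^ r - c)"
  define b where "b = c * x'"
  have "b ^ r = x * x' ^ (r - 1)"
    using r_pos power_minus_mult[of r x'] by (simp add: b_def c power_mult_distrib mult_ac)
  then have b: "b \<in> F_minus" using x x' by (metis F_minus_root F_minus_mult F_minus_power)
  define M where "M = x' ^ (r * r)"
  define h1 where "h1 v = (v * M) ^ r * N ^ (r - 1) - (v * M) * x' ^ (r - 1)" for v
  define h2 where "h2 v = (v * M) ^ r * (c * N ^ (r - 1)) - (v * M) * (x' ^ (r - 1) * (c ^ r) ^ r)" for v
  have M0: "M \<noteq> 0" using x' by (simp add: M_def)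
  have crM: "(c ^ r) ^ r * M = b ^ (r * r)"
    by (simp add: M_def b_def power_mult_distrib flip: power_mult)
  have cM: "c * M = b * x' ^ (r * r - 1)"
    using r_pos power_minus_mult[of "r * r" x'] by (simp add: M_def b_def mult_ac)
  have NM: "N * M \<in> F_minus"
  proof -
    have "N * M = x' ^ (r - 1) * ((c ^ r) ^ r * M - c * M)" by (simp add: N_def algebra_simps)
    then show ?thesis unfolding crM cM using b x' by (auto intro!: F_minus_closed)
  qed
  have Mr: "M ^ r = M ^ (r - 1) * M" using r_pos by (metis power_minus_mult)
  have NMr: "N ^ (r - 1) * M ^ r = (N * M) ^ (r - 1) * M"
    unfolding Mr by (simp add: power_mult_distrib mult_ac)
  have MR: "M \<in> F_minus" using x' by (auto simp: M_def intro: F_minus_power)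
  have h1: "h1 v = v ^ r * ((N * M) ^ (r - 1) * M) - v * (M * x' ^ (r - 1))" for v
    unfolding h1_def NMr[symmetric] by (simp add: power_mult_distrib mult_ac)
  have h2: "h2 v = v ^ r * ((N * M) ^ (r - 1) * (b * x' ^ (r * r - 1))) - v * (x' ^ (r - 1) * b ^ (r * r))" for v
    unfolding h2_def cM[symmetric] crM[symmetric] power_mult_distrib Mr by (simp add: mult_ac)
  have closed: "h1 v \<in> F_minus \<and> h2 v \<in> F_minus" if "v \<in> F_minus" for v
    unfolding h1 h2 using NM MR b x' that by (auto intro!: F_minus_closed)
  have diff: "h1 (v - w) = h1 v - h1 w \<and> h2 (v - w) = h2 v - h2 w" for v w
    unfolding h1 h2 by (simp add: frobenius_diff algebra_simps)
  have inf: "infinite {v \<in> F_minus. \<forall>h\<in>{h1, h2}. h v \<in> V}"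
    by (rule finite_coindex_common_preimage[OF V]) (use closed diff in auto)
  \<comment> \<open>Fibres are zero sets of nonzero polynomials, so infinitely many parameters give infinitely many solutions.\<close>
  have fib: "finite {v. h1 v = y}" for y
  proof -
    define P where "P = monom ((N * M) ^ (r - 1) * M) r - monom (M * x' ^ (r - 1)) 1 - [:y:]"
    have "coeff P 1 \<noteq> 0" using r_gt_1 M0 x' by (simp add: P_def coeff_pCons)
    then have "P \<noteq> 0" by auto
    then have "finite {v. poly P v = 0}" by (rule poly_roots_finite)
    then show ?thesis by (simp add: P_def poly_monom h1 mult_ac)
  qed
  have "(\<lambda>v. (h1 v, h2 v)) ` {v \<in> F_minus. \<forall>h\<in>{h1, h2}. h v \<in> V} \<subseteq>
      {(y, y'). y \<in> V \<and> y' \<in> V \<and> commutator_form r x y = commutator_form r x' y'}"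
    unfolding c h1_def h2_def N_def using comm_eq_solution[OF x'(2)] by auto
  moreover have "infinite ((\<lambda>v. (h1 v, h2 v)) ` {v \<in> F_minus. \<forall>h\<in>{h1, h2}. h v \<in> V})"
  proof
    assume "finite ((\<lambda>v. (h1 v, h2 v)) ` {v \<in> F_minus. \<forall>h\<in>{h1, h2}. h v \<in> V})"
    from pigeonhole_infinite[OF inf this] obtain v0
      where "infinite {v \<in> {v \<in> F_minus. \<forall>h\<in>{h1, h2}. h v \<in> V}. (h1 v, h2 v) = (h1 v0, h2 v0)}" by blast
    then show False by (rule notE) (rule finite_subset[OF _ fib[of "h1 v0"]], auto)
  qed
  ultimately show ?thesis by (meson finite_subset)
qed

text \<open>The equation says \<open>x y\<^sup>r - x' y'\<^sup>r = x\<^sup>r y - x'\<^sup>r y'\<close>.  If \<open>y\<close> has the larger degree, the left side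
has degree at least \<open>r \<cdot> deg y\<close> and the right side at most \<open>deg y\<close>, up to constants.\<close>

lemma comm_eq_subdegree_bound:
  fixes x x' :: "'a fls"
  assumes "x \<noteq> 0" "x' \<noteq> 0" and np: "\<nexists>c. x = c ^ r * x'"
  obtains B where "\<And>y y'. y \<in> F_minus \<Longrightarrow> y \<noteq> 0 \<Longrightarrow> y' = 0 \<or> fls_subdegree y \<le> fls_subdegree y' \<Longrightarrow>
     commutator_form r x y = commutator_form r x' y' \<Longrightarrow> B \<le> fls_subdegree y"
proof -
  obtain C where C: "\<And>y y'. y \<noteq> 0 \<Longrightarrow> x * y ^ r - x' * y' ^ r \<noteq> 0 \<and>
           fls_subdegree (x * y ^ r - x' * y' ^ r) \<le> C + int r * fls_subdegree y"
    using subdegree_non_power_le[OF assms] by blast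
  define K where "K = min (int r * fls_subdegree x) (int r * fls_subdegree x')"
  show thesis
  proof (rule that[of "- \<bar>K - C\<bar>"])
    fix y y' assume y: "y \<in> F_minus" "y \<noteq> 0" and y': "y' = 0 \<or> fls_subdegree y \<le> fls_subdegree y'"
      and eq: "commutator_form r x y = commutator_form r x' y'"
    have eq': "x ^ r * y - x' ^ r * y' = x * y ^ r - x' * y' ^ r"
      using eq by (simp add: commutator_form_def algebra_simps)
    have "K + fls_subdegree y \<le> fls_subdegree (x ^ r * y - x' ^ r * y')"
    proof (rule fls_subdegree_geI)
      show "x ^ r * y - x' ^ r * y' \<noteq> 0" unfolding eq' using C[OF y(2)] by blast
      fix n assume n: "n < K + fls_subdegree y"
      have "(x ^ r * y) $$ n = 0"
        by (rule fls_times_nth_eq0) (use n in \<open>simp add: fls_subdegree_pow K_def\<close>)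
      moreover have "(x' ^ r * y') $$ n = 0"
      proof (cases "y' = 0")
        case False
        then show ?thesis
          by (intro fls_times_nth_eq0) (use n y' in \<open>auto simp add: fls_subdegree_pow K_def\<close>)
      qed simp
      ultimately show "(x ^ r * y - x' ^ r * y') $$ n = 0" by simp
    qed
    also have "\<dots> \<le> C + int r * fls_subdegree y" unfolding eq' using C[OF y(2)] by blast
    finally have "K - C \<le> (int r - 1) * fls_subdegree y" by (simp add: algebra_simps)
    moreover have "(int r - 1) * fls_subdegree y \<le> 1 * fls_subdegree y"
      by (rule mult_right_mono_neg) (use r_gt_1 F_minus_subdegree[OF y(1)] in auto)
    ultimately show "- \<bar>K - C\<bar> \<le> fls_subdegree y" by simp
  qed
qed

lemma finite_comm_eq:
  fixes x x' :: "'a fls"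
  assumes x: "x \<noteq> 0" "x' \<noteq> 0" and np: "\<nexists>c. x = c ^ r * x'"
  shows "finite {(y, y'). y \<in> F_minus \<and> y' \<in> F_minus \<and> commutator_form r x y = commutator_form r x' y'}"
proof -
  have np': "\<nexists>c. x' = c ^ r * x"
  proof
    assume "\<exists>c. x' = c ^ r * x"
    then obtain c where "x' = c ^ r * x" by blast
    then have "x = (inverse c) ^ r * x'" using x r_pos by (auto simp: field_simps zero_power)
    with np show False by blast
  qed
  obtain B where B: "\<And>y y'. y \<in> F_minus \<Longrightarrow> y \<noteq> 0 \<Longrightarrow> y' = 0 \<or> fls_subdegree y \<le> fls_subdegree y' \<Longrightarrow>
     commutator_form r x y = commutator_form r x' y' \<Longrightarrow> B \<le> fls_subdegree y"
    using comm_eq_subdegree_bound[OF x np] by metis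
  obtain B' where B': "\<And>y y'. y' \<in> F_minus \<Longrightarrow> y' \<noteq> 0 \<Longrightarrow> y = 0 \<or> fls_subdegree y' \<le> fls_subdegree y \<Longrightarrow>
     commutator_form r x y = commutator_form r x' y' \<Longrightarrow> B' \<le> fls_subdegree y'"
    using comm_eq_subdegree_bound[OF x(2,1) np'] by metis
  let ?A = "{f \<in> (F_minus :: 'a fls set). f = 0 \<or> fls_subdegree f \<ge> min B B'}"
  have "{(y, y'). y \<in> F_minus \<and> y' \<in> F_minus \<and> commutator_form r x y = commutator_form r x' y'} \<subseteq> ?A \<times> ?A"
  proof (rule subsetI)
    fix z assume "z \<in> {(y, y'). y \<in> F_minus \<and> y' \<in> F_minus \<and> commutator_form r x y = commutator_form r x' y'}"
    then obtain y y' where z: "z = (y, y')"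
      and y: "y \<in> F_minus" "y' \<in> F_minus" "commutator_form r x y = commutator_form r x' y'" by blast
    consider "y \<noteq> 0" "y' = 0 \<or> fls_subdegree y \<le> fls_subdegree y'" |
      "y' \<noteq> 0" "y = 0 \<or> fls_subdegree y' \<le> fls_subdegree y" | "y = 0" "y' = 0" by linarith
    then have "(y, y') \<in> ?A \<times> ?A"
    proof cases
      case 1
      with B[of y y'] y show ?thesis by (auto simp: min_le_iff_disj)
    next
      case 2
      with B'[of y' y] y show ?thesis by (auto simp: min_le_iff_disj)
    qed (use y in simp)
    then show "z \<in> ?A \<times> ?A" by (simp add: z)
  qed
  then show ?thesis by (rule finite_subset) (intro finite_cartesian_product finite_F_minus_bounded)
qed

lemma X_inv_not_power: "fls_X_inv \<noteq> (c ^ r :: 'a fls)"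
proof
  assume "fls_X_inv = c ^ r"
  moreover have "\<not> int r dvd - 1" using zdvd_imp_le[of "int r" 1] r_gt_1 by auto
  then have "(c ^ r) $$ (- 1) = 0" by (simp only: frobenius_nth if_False)
  moreover have "fls_X_inv $$ (- 1) = (1::'a)" by simp
  ultimately show False by simp
qed

end

section \<open>Additive maps that preserve the commutator form\<close>

text \<open>The map that an isomorphism between subgroups of finite index in \<open>G\<^sub>2(\<F>\<^sub>q[t\<^sup>-\<^sup>1])\<close> induces modulo the
centres.  The hypotheses are invariant under inversion, which later turns an inclusion of rings into an
equality.\<close>

locale commutator_map = frobenius_power r k field_type
  for r k :: nat and field_type :: "'a::{field,finite} itself" +
  fixes V W :: "'a fls set" and f :: "'a fls \<Rightarrow> 'a fls"
  assumes V: "finite_coindex V" and W: "finite_coindex W" and bij: "bij_betw f V W"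
    and f_add: "\<And>x y. x \<in> V \<Longrightarrow> y \<in> V \<Longrightarrow> f (x + y) = f x + f y"
    and f_comm: "\<And>x y x' y'. x \<in> V \<Longrightarrow> y \<in> V \<Longrightarrow> x' \<in> V \<Longrightarrow> y' \<in> V \<Longrightarrow>
       commutator_form r (f x) (f y) = commutator_form r (f x') (f y') \<longleftrightarrow> commutator_form r x y = commutator_form r x' y'"
begin

lemma inverse_commutator_map: "commutator_map r k W V (inv_into V f)"
proof unfold_locales
  have inW: "inv_into V f w \<in> V" "f (inv_into V f w) = w" if "w \<in> W" for w
    using that bij by (auto simp: bij_betw_def inv_into_into f_inv_into_f)
  show "bij_betw (inv_into V f) W V" by (rule bij_betw_inv_into[OF bij])
  show "inv_into V f (x + y) = inv_into V f x + inv_into V f y" if "x \<in> W" "y \<in> W" for x y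
  proof -
    have "f (inv_into V f x + inv_into V f y) = x + y"
      using that by (simp add: f_add inW)
    then show ?thesis
      using bij inW[OF that(1)] inW[OF that(2)]
      by (metis bij_betw_def finite_coindex_add[OF V] inv_into_f_f)
  qed
  show "commutator_form r (inv_into V f x) (inv_into V f y) = commutator_form r (inv_into V f x') (inv_into V f y') \<longleftrightarrow>
      commutator_form r x y = commutator_form r x' y'" if "x \<in> W" "y \<in> W" "x' \<in> W" "y' \<in> W" for x y x' y'
    using f_comm[of "inv_into V f x" "inv_into V f y" "inv_into V f x'" "inv_into V f y'"] that
    by (simp add: inW)
qed (rule V W)+

lemmas V_F_minus = finite_coindex_subset[OF V]

lemma f_in_W: "x \<in> V \<Longrightarrow> f x \<in> W"
  using bij by (auto simp: bij_betw_def)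

lemma f_F_minus: "x \<in> V \<Longrightarrow> f x \<in> F_minus"
  by (rule finite_coindex_subset[OF W f_in_W])

lemma f_eq_0_iff: "x \<in> V \<Longrightarrow> f x = 0 \<longleftrightarrow> x = 0"
proof -
  have "f 0 = 0"
    using f_add[of 0 0] finite_coindex_0[OF V] by (metis add_cancel_right_right add_0_right)
  then show "x \<in> V \<Longrightarrow> f x = 0 \<longleftrightarrow> x = 0"
    using inj_on_eq_iff[of f V x 0] finite_coindex_0[OF V] bij by (simp add: bij_betw_def)
qed

text \<open>Two elements span the same line over \<open>F\<^sup>r\<close> exactly when infinitely many pairs give equal commutators, and
the latter condition is invariant under \<open>f\<close>.\<close>

lemma same_line_iff:
  assumes x: "x \<in> V" "x \<noteq> 0" and x': "x' \<in> V" "x' \<noteq> 0"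
  shows "(\<exists>c. f x = c ^ r * f x') \<longleftrightarrow> (\<exists>c. x = c ^ r * x')"
proof -
  define S where "S U x x' = {(y, y'). y \<in> U \<and> y' \<in> U \<and> commutator_form r x y = commutator_form r x' y'}"
    for U :: "'a fls set" and x x'
  have S: "(\<exists>c. x = c ^ r * x') \<longleftrightarrow> infinite (S U x x')"
    if "finite_coindex U" "x \<in> U" "x \<noteq> 0" "x' \<in> U" "x' \<noteq> 0" for U x x'
  proof
    assume "\<exists>c. x = c ^ r * x'"
    then show "infinite (S U x x')"
      using infinite_comm_eq[OF that(1)] that finite_coindex_subset[OF that(1)] unfolding S_def by blast
  next
    assume inf: "infinite (S U x x')"
    have "S U x x' \<subseteq> {(y, y'). y \<in> F_minus \<and> y' \<in> F_minus \<and> commutator_form r x y = commutator_form r x' y'}"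
      unfolding S_def using finite_coindex_subset[OF that(1)] by blast
    with inf show "\<exists>c. x = c ^ r * x'"
      using finite_comm_eq[OF that(3,5)] finite_subset by blast
  qed
  have "bij_betw (map_prod f f) (S V x x') (S W (f x) (f x'))"
  proof (rule bij_betw_imageI)
    have inj: "inj_on f V" and im: "f ` V = W" using bij by (auto simp: bij_betw_def)
    show "inj_on (map_prod f f) (S V x x')"
      by (rule inj_on_subset[OF map_prod_inj_on[OF inj inj]]) (auto simp: S_def)
    show "map_prod f f ` S V x x' = S W (f x) (f x')"
      unfolding S_def im[symmetric] using f_comm x x' by (auto simp: image_iff)
  qed
  then have "finite (S V x x') \<longleftrightarrow> finite (S W (f x) (f x'))" by (rule bij_betw_finite)
  with S[OF V x x'] S[OF W, of "f x" "f x'"] x x' show ?thesis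
    by (simp add: f_in_W f_eq_0_iff)
qed

text \<open>This is the core of the fundamental theorem of projective geometry.  By \<open>same_line_iff\<close> each \<open>f (l\<^sup>r x)\<close>
is a multiple \<open>c\<^sup>r f x\<close>.  For \<open>x, y\<close> on different lines, evaluating \<open>f\<close> at \<open>l\<^sup>r (x + y)\<close> in two ways
shows that \<open>x\<close> and \<open>y\<close> have the same factor \<open>c\<close>; two elements of one line are compared through a third
element \<open>w\<close> off that line.\<close>

lemma semilinear_factor:
  assumes l: "l \<in> F_minus"
  shows "\<exists>c. \<forall>x\<in>V. l ^ r * x \<in> V \<longrightarrow> f (l ^ r * x) = c ^ r * f x"
proof (cases "l = 0")
  case True
  then show ?thesis
    using r_pos f_eq_0_iff[OF finite_coindex_0[OF V]] by (intro exI[of _ 0]) (simp add: zero_power)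
next
  case False
  define dom where "dom = {x \<in> V. x \<noteq> 0 \<and> l ^ r * x \<in> V}"
  have ex: "\<exists>c. f (l ^ r * x) = c ^ r * f x" if "x \<in> dom" for x
    using same_line_iff[of "l ^ r * x" x] that False by (auto simp: dom_def)
  have eq: "a = b" if x: "x \<in> dom" "f (l ^ r * x) = a ^ r * f x" and y: "y \<in> dom" "f (l ^ r * y) = b ^ r * f y"
    and ind: "\<nexists>c. x = c ^ r * y" for x y a b
  proof -
    have V': "x \<in> V" "y \<in> V" "l ^ r * x \<in> V" "l ^ r * y \<in> V" and 0: "x \<noteq> 0" "y \<noteq> 0"
      using x y by (auto simp: dom_def)
    have "x + y \<noteq> 0"
    proof
      assume "x + y = 0"
      then have "x = (- 1) ^ r * y" by (simp add: frobenius_uminus eq_neg_iff_add_eq_0)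
      with ind show False by blast
    qed
    then have "x + y \<in> dom"
      using V' finite_coindex_add[OF V] by (simp add: dom_def algebra_simps)
    then obtain c where "f (l ^ r * (x + y)) = c ^ r * f (x + y)" using ex by blast
    then have "a ^ r * f x + b ^ r * f y = c ^ r * f x + c ^ r * f y"
      using x y V' by (simp add: f_add algebra_simps)
    then have c: "(c - a) ^ r * f x = (b - c) ^ r * f y"
      by (simp add: frobenius_diff algebra_simps)
    have "c = a"
    proof (rule ccontr)
      assume "c \<noteq> a"
      then have "f x = ((b - c) / (c - a)) ^ r * f y"
        using c by (simp add: power_divide field_simps)
      then show False using same_line_iff[of x y] V' 0 ind by blast
    qed
    with c r_pos f_eq_0_iff[OF V'(2)] 0 show "a = b" by (simp add: zero_power)
  qed
  obtain x0 where x0: "x0 \<in> V" "x0 \<noteq> 0" "l ^ r * x0 \<in> V"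
    by (rule finite_coindex_multiplier[OF V, of "{l ^ r}"]) (use l in \<open>auto intro: F_minus_power\<close>)
  then have x0d: "x0 \<in> dom" by (simp add: dom_def)
  then obtain c0 where c0: "f (l ^ r * x0) = c0 ^ r * f x0" using ex by blast
  let ?A = "{fls_X_inv, l ^ r, l ^ r * fls_X_inv}"
  obtain w0 where w0: "w0 \<in> V" "w0 \<noteq> 0" and w0_mult: "\<And>a. a \<in> ?A \<Longrightarrow> a * w0 \<in> V"
    by (rule finite_coindex_multiplier[OF V, of ?A]) (use l in \<open>auto intro: F_minus_power F_minus_mult\<close>)
  \<comment> \<open>Since \<open>t\<^sup>-\<^sup>1\<close> is not an \<open>r\<close>-th power, \<open>w0\<close> and \<open>t\<^sup>-\<^sup>1 w0\<close> lie on different lines.\<close>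
  have "\<exists>w\<in>{w0, fls_X_inv * w0}. \<nexists>c. w = c ^ r * x0"
  proof (rule ccontr)
    assume "\<not> ?thesis"
    then obtain a b where "w0 = a ^ r * x0" "fls_X_inv * w0 = b ^ r * x0" by blast
    with w0 x0 have "fls_X_inv = (b / a) ^ r" by (auto simp: power_divide field_simps)
    with X_inv_not_power show False by blast
  qed
  then obtain w where w: "w \<in> {w0, fls_X_inv * w0}" and wx0: "\<nexists>c. w = c ^ r * x0" ..
  have "{w0, fls_X_inv * w0} \<subseteq> dom"
    using w0 w0_mult[of fls_X_inv] w0_mult[of "l ^ r"] w0_mult[of "l ^ r * fls_X_inv"]
    by (simp add: dom_def mult.assoc)
  with w have w: "w \<in> dom" by blast
  obtain cw where cw: "f (l ^ r * w) = cw ^ r * f w" using ex w by blast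
  have "cw = c0" by (rule eq[OF w cw x0d c0 wx0])
  have "f (l ^ r * x) = c0 ^ r * f x" if "x \<in> V" "l ^ r * x \<in> V" for x
  proof (cases "x = 0")
    case True
    with f_eq_0_iff[OF that(1)] show ?thesis by simp
  next
    case False
    with that have x: "x \<in> dom" by (simp add: dom_def)
    then obtain c where c: "f (l ^ r * x) = c ^ r * f x" using ex by blast
    have "c = c0"
    proof (cases "\<exists>c. x = c ^ r * x0")
      case True
      then obtain d where d: "x = d ^ r * x0" by blast
      have "\<nexists>c. w = c ^ r * x"
      proof
        assume "\<exists>c. w = c ^ r * x"
        then obtain c where "w = c ^ r * x" by blast
        then have "w = (c * d) ^ r * x0" by (simp add: d power_mult_distrib mult.assoc)
        with wx0 show False by blast
      qed
      from eq[OF w cw x c this] \<open>cw = c0\<close> show ?thesis by simp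
    qed (rule eq[OF x c x0d c0])
    with c show ?thesis by simp
  qed
  then show ?thesis by blast
qed

definition factor :: "'a fls \<Rightarrow> 'a fls" where
  "factor l = (SOME c. \<forall>x\<in>V. l ^ r * x \<in> V \<longrightarrow> f (l ^ r * x) = c ^ r * f x)"

lemma f_semilinear: "l \<in> F_minus \<Longrightarrow> x \<in> V \<Longrightarrow> l ^ r * x \<in> V \<Longrightarrow> f (l ^ r * x) = factor l ^ r * f x"
  unfolding factor_def using someI_ex[OF semilinear_factor] by blast

lemma power_multiplier:
  assumes "finite A" "A \<subseteq> F_minus"
  obtains u where "u \<in> F_minus" "u \<noteq> 0" "\<And>a. a \<in> A \<Longrightarrow> u ^ r * a \<in> V"
proof -
  have "infinite {u \<in> F_minus. \<forall>h\<in>(\<lambda>a u. u ^ r * a) ` A. h u \<in> V}"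
    by (rule finite_coindex_common_preimage[OF V])
      (use assms in \<open>auto simp: algebra_simps frobenius_diff intro!: F_minus_closed\<close>)
  then obtain u where "u \<in> {u \<in> F_minus. \<forall>h\<in>(\<lambda>a u. u ^ r * a) ` A. h u \<in> V} - {0}"
    by (metis (no_types, lifting) finite.emptyI infinite_remove ex_in_conv)
  then show thesis by (intro that[of u]) auto
qed

text \<open>A single nonzero test element determines the factor, which gives the ring homomorphism laws below.\<close>

lemma factor_eqI:
  assumes "l \<in> F_minus" "x \<in> V" "x \<noteq> 0" "l ^ r * x \<in> V" "f (l ^ r * x) = c ^ r * f x"
  shows "factor l = c"
proof -
  have "factor l ^ r * f x = c ^ r * f x" using f_semilinear[OF assms(1,2,4)] assms(5) by metis
  moreover have "f x \<noteq> 0" using f_eq_0_iff[OF assms(2)] assms(3) by blast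
  ultimately show ?thesis by (simp add: frobenius_inj)
qed

lemma common_multiplier:
  assumes "a \<in> F_minus" "b \<in> F_minus"
  obtains x where "x \<in> V" "x \<noteq> 0" "a * x \<in> V" "b * x \<in> V"
proof -
  obtain x where "x \<in> V" "x \<noteq> 0" and "\<And>c. c \<in> {a, b} \<Longrightarrow> c * x \<in> V"
    by (rule finite_coindex_multiplier[OF V, of "{a, b}"]) (use assms in auto)
  then show thesis by (intro that) auto
qed

lemma factor_add:
  assumes "l \<in> F_minus" "m \<in> F_minus"
  shows "factor (l + m) = factor l + factor m"
proof -
  obtain x where x: "x \<in> V" "x \<noteq> 0" "l ^ r * x \<in> V" "m ^ r * x \<in> V"
    by (rule common_multiplier[of "l ^ r" "m ^ r"]) (use assms in \<open>auto intro: F_minus_power\<close>)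
  have lm: "(l + m) ^ r * x = l ^ r * x + m ^ r * x" by (simp add: frobenius_add algebra_simps)
  have "f ((l + m) ^ r * x) = (factor l ^ r + factor m ^ r) * f x"
    unfolding lm f_add[OF x(3,4)] f_semilinear[OF assms(1) x(1,3)] f_semilinear[OF assms(2) x(1,4)]
    by (simp add: distrib_right)
  then show ?thesis
    using lm x finite_coindex_add[OF V]
    by (intro factor_eqI[of _ x] F_minus_add assms) (simp_all add: frobenius_add)
qed

lemma factor_mult:
  assumes "l \<in> F_minus" "m \<in> F_minus"
  shows "factor (l * m) = factor l * factor m"
proof -
  obtain x where x: "x \<in> V" "x \<noteq> 0" "m ^ r * x \<in> V" "l ^ r * m ^ r * x \<in> V"
    by (rule common_multiplier[of "m ^ r" "l ^ r * m ^ r"])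
      (use assms in \<open>auto intro: F_minus_power F_minus_mult\<close>)
  have lm: "(l * m) ^ r * x = l ^ r * (m ^ r * x)" by (simp add: power_mult_distrib mult.assoc)
  have V': "l ^ r * (m ^ r * x) \<in> V" using x(4) by (simp add: mult.assoc)
  have "f ((l * m) ^ r * x) = factor l ^ r * (factor m ^ r * f x)"
    unfolding lm f_semilinear[OF assms(1) x(3) V'] f_semilinear[OF assms(2) x(1,3)] ..
  then show ?thesis
    using lm x V' by (intro factor_eqI[of _ x] F_minus_mult assms) (simp_all add: power_mult_distrib mult.assoc)
qed

lemma factor_1: "factor 1 = 1"
proof -
  obtain x where "x \<in> V" "x \<noteq> 0" by (rule finite_coindex_multiplier[OF V, of "{}"]) auto
  then show ?thesis by (intro factor_eqI[of _ x]) auto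
qed

lemma factor_0: "factor 0 = 0"
  using factor_add[of 0 0] by (metis F_minus_0 add_cancel_right_right add_0_right)

lemma factor_diff: "l \<in> F_minus \<Longrightarrow> m \<in> F_minus \<Longrightarrow> factor (l - m) = factor l - factor m"
  using factor_add[of "l - m" m] by (simp add: F_minus_diff)

lemma factor_power: "l \<in> F_minus \<Longrightarrow> factor (l ^ n) = factor l ^ n"
  by (induction n) (auto simp: factor_1 factor_mult F_minus_power)

lemma factor_eq_0_iff:
  assumes "l \<in> F_minus"
  shows "factor l = 0 \<longleftrightarrow> l = 0"
proof
  assume "factor l = 0"
  obtain x where x: "x \<in> V" "x \<noteq> 0" "l ^ r * x \<in> V"
    by (rule finite_coindex_multiplier[OF V, of "{l ^ r}"]) (use assms in \<open>auto intro: F_minus_power\<close>)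
  have "f (l ^ r * x) = 0" using f_semilinear[OF assms x(1,3)] \<open>factor l = 0\<close> r_pos by (simp add: zero_power)
  then show "l = 0" using f_eq_0_iff[OF x(3)] x(2) r_pos by simp
qed (simp add: factor_0)

lemma inj_factor: "inj_on factor F_minus"
  using factor_eq_0_iff factor_diff by (auto simp: inj_on_def) (metis F_minus_diff right_minus_eq)

text \<open>The semilinear extension of \<open>f\<close> from \<open>V\<close> to the whole polynomial ring.  Every element can be moved into
\<open>V\<close> by multiplication with some nonzero \<open>u\<^sup>r\<close>; \<open>extension_eq\<close> shows that the choice of \<open>u\<close> is irrelevant.\<close>

definition extension :: "'a fls \<Rightarrow> 'a fls" where
  "extension x = (let u = (SOME u. u \<in> F_minus \<and> u \<noteq> 0 \<and> u ^ r * x \<in> V) in f (u ^ r * x) / factor u ^ r)"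

lemma extension_eq:
  assumes x: "x \<in> F_minus" and u: "u \<in> F_minus" "u ^ r * x \<in> V"
  shows "f (u ^ r * x) = factor u ^ r * extension x"
proof -
  define v where "v = (SOME v. v \<in> F_minus \<and> v \<noteq> 0 \<and> v ^ r * x \<in> V)"
  have "\<exists>v. v \<in> F_minus \<and> v \<noteq> 0 \<and> v ^ r * x \<in> V"
    by (rule power_multiplier[of "{x}"]) (use x in auto)
  then have v: "v \<in> F_minus" "v \<noteq> 0" "v ^ r * x \<in> V" unfolding v_def by (metis (mono_tags, lifting) someI_ex)+
  have extension: "extension x = f (v ^ r * x) / factor v ^ r" by (simp add: extension_def v_def Let_def)
  obtain w where w: "w \<in> F_minus" "w \<noteq> 0" "w ^ r * ((u * v) ^ r * x) \<in> V"
    by (rule power_multiplier[of "{(u * v) ^ r * x}"]) (use x u v in \<open>auto intro!: F_minus_closed\<close>)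
  have "(w * v) ^ r * (u ^ r * x) = w ^ r * ((u * v) ^ r * x)" "(w * u) ^ r * (v ^ r * x) = w ^ r * ((u * v) ^ r * x)"
    by (simp_all add: power_mult_distrib mult_ac)
  with f_semilinear[of "w * v" "u ^ r * x"] f_semilinear[of "w * u" "v ^ r * x"] u v w
  have "factor (w * v) ^ r * f (u ^ r * x) = factor (w * u) ^ r * f (v ^ r * x)"
    by (simp add: F_minus_mult)
  then show ?thesis
    using u v w by (simp add: factor_mult power_mult_distrib extension factor_eq_0_iff field_simps)
qed

lemma extension_V: "x \<in> V \<Longrightarrow> extension x = f x"
  using extension_eq[of x 1] by (simp add: factor_1 V_F_minus)

lemma extension_add:
  assumes "x \<in> F_minus" "y \<in> F_minus"
  shows "extension (x + y) = extension x + extension y"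
proof -
  obtain u where u: "u \<in> F_minus" "u \<noteq> 0" and uV: "\<And>a. a \<in> {x, y} \<Longrightarrow> u ^ r * a \<in> V"
    by (rule power_multiplier[of "{x, y}"]) (use assms in auto)
  have u: "u \<in> F_minus" "u \<noteq> 0" "u ^ r * x \<in> V" "u ^ r * y \<in> V" using u uV by auto
  have "u ^ r * (x + y) \<in> V" using u finite_coindex_add[OF V] by (simp add: algebra_simps)
  from extension_eq[OF _ u(1) this] have "factor u ^ r * extension (x + y) = f (u ^ r * x + u ^ r * y)"
    using assms by (simp add: F_minus_add distrib_left)
  also have "\<dots> = factor u ^ r * (extension x + extension y)"
    using u assms by (simp add: f_add extension_eq distrib_left)
  finally show ?thesis using u by (simp add: factor_eq_0_iff)
qed

lemma extension_0: "extension 0 = 0" using extension_add[of 0 0] by (metis F_minus_0 add_cancel_right_right add_0_right)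

lemma extension_diff: "x \<in> F_minus \<Longrightarrow> y \<in> F_minus \<Longrightarrow> extension (x - y) = extension x - extension y"
  using extension_add[of "x - y" y] by (simp add: F_minus_diff)

lemma extension_semilinear:
  assumes "l \<in> F_minus" "x \<in> F_minus"
  shows "extension (l ^ r * x) = factor l ^ r * extension x"
proof -
  have lx: "l ^ r * x \<in> F_minus" using assms by (intro F_minus_closed)
  obtain u where u: "u \<in> F_minus" "u \<noteq> 0" and uV: "\<And>a. a \<in> {x, l ^ r * x} \<Longrightarrow> u ^ r * a \<in> V"
    by (rule power_multiplier[of "{x, l ^ r * x}"]) (use assms lx in auto)
  have u: "u \<in> F_minus" "u \<noteq> 0" "u ^ r * x \<in> V" "u ^ r * (l ^ r * x) \<in> V" using u uV by auto
  have "factor u ^ r * extension (l ^ r * x) = f (u ^ r * (l ^ r * x))"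
    using extension_eq[OF lx u(1,4)] by simp
  also have "\<dots> = f ((l * u) ^ r * x)" by (simp add: power_mult_distrib mult_ac)
  also have "\<dots> = factor (l * u) ^ r * extension x"
    using u assms by (intro extension_eq) (auto simp: F_minus_mult power_mult_distrib mult_ac)
  finally show ?thesis using u assms by (simp add: factor_mult power_mult_distrib factor_eq_0_iff)
qed

lemma extension_comm:
  assumes xy: "x \<in> F_minus" "y \<in> F_minus" "x' \<in> F_minus" "y' \<in> F_minus" and eq: "commutator_form r x y = commutator_form r x' y'"
  shows "commutator_form r (extension x) (extension y) = commutator_form r (extension x') (extension y')"
proof -
  obtain u where u: "u \<in> F_minus" "u \<noteq> 0"
    and uV: "\<And>a. a \<in> {x, y, x', y'} \<Longrightarrow> u ^ r * a \<in> V"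
    by (rule power_multiplier[of "{x, y, x', y'}"]) (use xy in auto)
  have u: "u \<in> F_minus" "u \<noteq> 0" "u ^ r * x \<in> V" "u ^ r * y \<in> V" "u ^ r * x' \<in> V" "u ^ r * y' \<in> V"
    using u uV by auto
  have "commutator_form r (u ^ r * x) (u ^ r * y) = commutator_form r (u ^ r * x') (u ^ r * y')" by (simp only: comm_mult eq)
  then have "commutator_form r (f (u ^ r * x)) (f (u ^ r * y)) = commutator_form r (f (u ^ r * x')) (f (u ^ r * y'))"
    using f_comm u by blast
  then show ?thesis using u xy by (simp add: extension_eq comm_mult factor_eq_0_iff)
qed

lemma extension_eq_0_iff:
  assumes "x \<in> F_minus"
  shows "extension x = 0 \<longleftrightarrow> x = 0"
proof
  assume "extension x = 0"
  obtain u where u: "u \<in> F_minus" "u \<noteq> 0" "u ^ r * x \<in> V" by (rule power_multiplier[of "{x}"]) (use assms in auto)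
  then have "f (u ^ r * x) = 0" using extension_eq[OF assms u(1,3)] \<open>extension x = 0\<close> by simp
  then show "x = 0" using f_eq_0_iff[OF u(3)] u(2) by simp
qed (simp add: extension_0)

text \<open>Put \<open>v = u\<^sup>r\<close> in \<open>comm_eq_solution\<close> and apply the extension of \<open>f\<close>.  With \<open>U = (\<tau> u)\<^sup>r\<close>, where \<open>\<tau>\<close> is
\<open>factor\<close>, the image of the solution is polynomial in \<open>U\<close> with coefficients independent of \<open>u\<close>, and
\<open>comm_eq_iff\<close> reads \<open>(A U\<^sup>r - B U)\<^sup>r = C U\<^sup>r - D U\<close>.  This holds for infinitely many \<open>U\<close>, so
comparing coefficients of \<open>U\<^bsup>r*r\<^esup>\<close> gives \<open>A = 0\<close>, which is the assertion.\<close>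

lemma extension_mult_special:
  assumes e: "e \<in> F_minus" "e \<noteq> 0" and d: "d \<in> F_minus"
  defines "N \<equiv> e ^ (r - 1) * ((d ^ r) ^ r - d)"
  shows "extension (d * N ^ (r - 1)) = factor d * extension (N ^ (r - 1))"
proof -
  define \<delta> E where "\<delta> = factor d" and "E = extension e"
  define G1 G2 G3 G4 where "G1 = extension (N ^ (r - 1))" and "G2 = extension (e ^ (r - 1))"
    and "G3 = extension (d * N ^ (r - 1))" and "G4 = extension (e ^ (r - 1) * (d ^ r) ^ r)"
  define A where "A = \<delta> * G1 - G3"
  define B where "B = \<delta> * G2 - G4"
  define C where "C = E ^ (r - 1) * ((\<delta> ^ r) ^ r * G1 - G3)"
  define D where "D = E ^ (r - 1) * ((\<delta> ^ r) ^ r * G2 - G4)"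
  have NR: "N \<in> F_minus" unfolding N_def by (intro F_minus_closed e d)
  have E0: "E \<noteq> 0" using e by (simp add: E_def extension_eq_0_iff)
  have root: "(U ^ r) ^ r * A ^ r - U ^ r * B ^ r = U ^ r * C - U * D"
    if "u \<in> F_minus" "U = factor u ^ r" for u U
  proof -
    have fu: "factor (u ^ r) ^ r = U ^ r" using that by (simp add: factor_power)
    define y where "y = (u ^ r) ^ r * N ^ (r - 1) - u ^ r * e ^ (r - 1)"
    define y' where "y' = (u ^ r) ^ r * (d * N ^ (r - 1)) - u ^ r * (e ^ (r - 1) * (d ^ r) ^ r)"
    have yR: "y \<in> F_minus" "y' \<in> F_minus"
      unfolding y_def y'_def by (intro F_minus_closed e d NR that)+
    have y: "extension y = U ^ r * G1 - U * G2"
      unfolding y_def G1_def G2_def using that fu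
      by (subst extension_diff, (intro F_minus_closed e d NR that)+, subst (1 2) extension_semilinear) (auto intro!: F_minus_closed e d NR)
    have y': "extension y' = U ^ r * G3 - U * G4"
      unfolding y'_def G3_def G4_def using that fu
      by (subst extension_diff, (intro F_minus_closed e d NR that)+, subst (1 2) extension_semilinear) (auto intro!: F_minus_closed e d NR)
    have "commutator_form r (extension (d ^ r * e)) (extension y) = commutator_form r (extension e) (extension y')"
      by (rule extension_comm) (use comm_eq_solution[OF e(2), of d "u ^ r"] in
        \<open>auto simp: y_def y'_def N_def intro!: F_minus_closed e d NR that\<close>)
    then have "commutator_form r (\<delta> ^ r * E) (extension y) = commutator_form r E (extension y')"
      using e d by (simp add: extension_semilinear \<delta>_def E_def)
    then have "(\<delta> * extension y - extension y') ^ r = E ^ (r - 1) * ((\<delta> ^ r) ^ r * extension y - extension y')"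
      by (simp only: comm_eq_iff[OF E0])
    moreover have "\<delta> * extension y - extension y' = U ^ r * A - U * B"
      by (simp add: y y' A_def B_def algebra_simps)
    moreover have "E ^ (r - 1) * ((\<delta> ^ r) ^ r * extension y - extension y') = U ^ r * C - U * D"
      by (simp add: y y' C_def D_def algebra_simps)
    ultimately show ?thesis by (simp add: frobenius_diff power_mult_distrib)
  qed
  define P where "P = monom (A ^ r) (r * r) - monom (B ^ r) r - monom C r + monom D 1"
  have "(\<lambda>u. factor u ^ r) ` F_minus \<subseteq> {U. poly P U = 0}"
    using root by (fastforce simp: P_def poly_monom power_mult algebra_simps)
  moreover have "inj_on (\<lambda>u. factor u ^ r) F_minus"
    using inj_factor by (auto simp: inj_on_def frobenius_inj)
  ultimately have "infinite {U. poly P U = 0}"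
    using infinite_F_minus by (meson finite_imageD finite_subset)
  then have "P = 0" using poly_roots_finite by blast
  moreover have "coeff P (r * r) = A ^ r" using r_gt_1 by (simp add: P_def)
  ultimately have "A = 0" using r_pos by simp
  then show ?thesis by (simp add: A_def \<delta>_def G1_def G3_def)
qed

text \<open>For \<open>e = x m\<close> with \<open>m = d\<^bsup>r*r\<^esup> - d\<close> one finds \<open>N\<^bsup>r-1\<^esup> = h\<^sup>r x\<close>, where
\<open>h = x\<^bsup>r-2\<^esup> m\<^bsup>r-1\<^esup>\<close>.  So \<open>extension_mult_special\<close>, which concerns powers \<open>N\<^bsup>r-1\<^esup>\<close> only, covers all
\<open>x\<close> up to semilinearity.\<close>

lemma extension_mult:
  assumes d: "d \<in> F_minus" "(d ^ r) ^ r \<noteq> d" and x: "x \<in> F_minus"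
  shows "extension (d * x) = factor d * extension x"
proof (cases "x = 0")
  case False
  define m where "m = (d ^ r) ^ r - d"
  define h where "h = x ^ (r - 2) * m ^ (r - 1)"
  have m: "m \<in> F_minus" "m \<noteq> 0" unfolding m_def using d by (auto intro!: F_minus_closed)
  have h: "h \<in> F_minus" "h \<noteq> 0" using m x False by (auto simp: h_def intro!: F_minus_closed)
  have N: "((x * m) ^ (r - 1) * m) ^ (r - 1) = h ^ r * x"
  proof -
    define j where "j = r - 2"
    have j: "r = Suc (Suc j)" "r - 1 = Suc j" using r_gt_1 by (auto simp: j_def)
    have "((x * m) ^ Suc j * m) ^ Suc j = x ^ (Suc j * Suc j) * m ^ (Suc (Suc j) * Suc j)"
      by (simp only: power_mult power_mult_distrib power_Suc mult_ac)
    also have "Suc j * Suc j = j * Suc (Suc j) + 1" by simp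
    also have "x ^ (j * Suc (Suc j) + 1) * m ^ (Suc (Suc j) * Suc j) = (x ^ j * m ^ Suc j) ^ Suc (Suc j) * x"
      by (simp only: power_add power_one_right power_mult_distrib mult_ac flip: power_mult)
    finally show ?thesis by (simp only: j(1) h_def j_def[symmetric] j(2) flip: j(1))
  qed
  have "extension (d * ((x * m) ^ (r - 1) * m) ^ (r - 1)) = factor d * extension (((x * m) ^ (r - 1) * m) ^ (r - 1))"
    unfolding m_def by (rule extension_mult_special) (use m x False d in \<open>auto simp: m_def intro: F_minus_mult\<close>)
  then have "extension (h ^ r * (d * x)) = factor d * extension (h ^ r * x)"
    unfolding N by (simp only: mult_ac)
  moreover have "extension (h ^ r * (d * x)) = factor h ^ r * extension (d * x)" "extension (h ^ r * x) = factor h ^ r * extension x"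
    using h d x by (auto intro: extension_semilinear F_minus_mult)
  ultimately show ?thesis using h by (simp add: factor_eq_0_iff)
qed (simp add: extension_0)

text \<open>The elements \<open>x\<close> excluded in \<open>extension_mult\<close> satisfy \<open>x\<^bsup>r*r\<^esup> = x\<close>; they become admissible after adding
\<open>t\<^sup>-\<^sup>1\<close>.\<close>

lemma extension_eq_factor:
  assumes "x \<in> F_minus"
  shows "extension x = extension 1 * factor x"
proof (cases "(x ^ r) ^ r = x")
  case False
  then show ?thesis using extension_mult[of x 1] assms by simp
next
  case True
  let ?s = "fls_X_inv :: 'a fls"
  have s: "(?s ^ r) ^ r \<noteq> ?s" using X_inv_not_power by metis
  have "((x + ?s) ^ r) ^ r \<noteq> x + ?s" using s True by (simp add: frobenius_add)
  then have "extension (x + ?s) = factor (x + ?s) * extension 1" using extension_mult[of "x + ?s" 1] assms by (simp add: F_minus_add)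
  moreover have "extension ?s = factor ?s * extension 1" using extension_mult[of ?s 1] s by simp
  ultimately show ?thesis using assms by (simp add: extension_add factor_add algebra_simps)
qed

lemma f_eq_factor: "x \<in> V \<Longrightarrow> f x = extension 1 * factor x"
  using extension_eq_factor[of x] by (simp add: extension_V V_F_minus)

lemma extension_1_nonzero: "extension 1 \<noteq> 0"
  by (simp add: extension_eq_0_iff)

text \<open>Let \<open>w = f x\<close> be a nonzero element of \<open>W\<close>, write \<open>\<tau>\<close> for \<open>factor\<close> and \<open>a\<close> for the value of the
extension at \<open>1\<close>.  The elements \<open>w c\<^sup>n = a \<cdot> \<tau> (l\<^sup>n x)\<close> fall into finitely many classes modulo \<open>W\<close>,
because \<open>V\<close> has finite index; so they have a common denominator.  Hence the ideal \<open>I\<close> of all \<open>z\<close> with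
\<open>z c\<^sup>n\<close> integral for every \<open>n\<close> is nonzero.  It is generated by an element \<open>z\<close> of least degree, and
\<open>c I \<subseteq> I\<close>; hence \<open>c z\<close> is a multiple of \<open>z\<close>.\<close>

lemma factor_F_minus:
  assumes l: "l \<in> F_minus"
  shows "factor l \<in> F_minus"
proof -
  define c where "c = factor l"
  define I where "I = {z \<in> F_minus. \<forall>n. z * c ^ n \<in> F_minus}"
  \<comment> \<open>One denominator \<open>Q\<close> of \<open>c\<close> itself is needed to treat the finitely many powers \<open>c\<^sup>m\<close> with \<open>m \<le> K\<close>.\<close>
  obtain Q where Q: "Q \<in> F_minus" "Q \<noteq> 0" "Q * c \<in> F_minus"
  proof -
    obtain x where x: "x \<in> V" "x \<noteq> 0" "l * x \<in> V"
      by (rule finite_coindex_multiplier[OF V, of "{l}"]) (use l in auto)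
    have "f (l * x) = f x * c" using x l by (simp add: f_eq_factor factor_mult V_F_minus c_def)
    with x show thesis using f_F_minus f_eq_0_iff that by metis
  qed
  have "\<exists>z\<in>I. z \<noteq> 0"
  proof -
    obtain x where x: "x \<in> V" "x \<noteq> 0"
      by (rule finite_coindex_multiplier[OF V, of "{}"]) auto
    define w where "w = f x"
    have w: "w \<in> F_minus" "w \<noteq> 0" using x by (auto simp: w_def f_F_minus f_eq_0_iff)
    have wc: "w * c ^ n = extension 1 * factor (l ^ n * x)" for n
      using x l by (simp add: w_def c_def f_eq_factor V_F_minus factor_mult F_minus_power factor_power)
    obtain col :: "'a fls \<Rightarrow> nat" where col: "finite (col ` F_minus)"
      "\<And>x y. x \<in> F_minus \<Longrightarrow> y \<in> F_minus \<Longrightarrow> col x = col y \<Longrightarrow> x - y \<in> V"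
      using V unfolding finite_coindex_def by blast
    have lx: "l ^ n * x \<in> F_minus" for n
      using l x by (simp add: F_minus_mult F_minus_power V_F_minus)
    define T where "T = range (\<lambda>n. col (l ^ n * x))"
    have "finite T" unfolding T_def by (rule finite_subset[OF _ col(1)]) (use lx in auto)
    \<comment> \<open>Each of the finitely many colours has an exponent representing it, and \<open>K\<close> bounds these exponents.\<close>
    define rep where "rep t = (SOME m. col (l ^ m * x) = t)" for t
    have rep: "col (l ^ rep t * x) = t" if "t \<in> T" for t
      using that unfolding T_def rep_def by (auto intro: someI)
    define K where "K = Max (rep ` T)"
    have le: "rep t \<le> K" if "t \<in> T" for t using that \<open>finite T\<close> by (simp add: K_def)
    have Qc: "Q ^ K * c ^ m \<in> F_minus" if "m \<le> K" for m
    proof -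
      have "Q ^ K * c ^ m = Q ^ (K - m) * (Q * c) ^ m"
        using that by (simp add: power_mult_distrib flip: power_add mult.assoc)
      then show ?thesis using Q by (simp add: F_minus_mult F_minus_power)
    qed
    have "Q ^ K * w * c ^ n \<in> F_minus" for n
    proof -
      define m where "m = rep (col (l ^ n * x))"
      have m: "col (l ^ m * x) = col (l ^ n * x)" "m \<le> K"
        using rep le by (auto simp: m_def T_def)
      have V': "l ^ n * x - l ^ m * x \<in> V" using m by (intro col lx) simp
      have "w * c ^ n - w * c ^ m = f (l ^ n * x - l ^ m * x)"
        using V' lx by (simp add: f_eq_factor wc factor_diff algebra_simps)
      then have "w * c ^ n - w * c ^ m \<in> F_minus" using f_F_minus[OF V'] by simp
      moreover have "Q ^ K * w * c ^ n = Q ^ K * (w * c ^ n - w * c ^ m) + w * (Q ^ K * c ^ m)"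
        by (simp add: algebra_simps)
      ultimately show ?thesis using Q w Qc[OF m(2)] by (auto intro!: F_minus_closed)
    qed
    moreover from this[of 0] have "Q ^ K * w \<in> F_minus" by simp
    ultimately show ?thesis using Q w by (intro bexI[of _ "Q ^ K * w"]) (auto simp: I_def)
  qed
  then obtain z where z: "z \<in> I" "z \<noteq> 0"
    and min: "\<And>y. y \<in> I \<Longrightarrow> y \<noteq> 0 \<Longrightarrow> nat (- fls_subdegree z) \<le> nat (- fls_subdegree y)"
    using exists_least_lemma[of "\<lambda>n. \<exists>z\<in>I. z \<noteq> 0 \<and> nat (- fls_subdegree z) = n"]
      ex_has_least_nat[of "\<lambda>z. z \<in> I \<and> z \<noteq> 0" _ "\<lambda>z. nat (- fls_subdegree z)"] by blast
  have zc: "z * c \<in> I"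
    unfolding I_def
  proof (intro CollectI conjI allI)
    show "z * c \<in> F_minus" using z(1) unfolding I_def by (metis (mono_tags, lifting) mem_Collect_eq power_one_right)
    show "z * c * c ^ n \<in> F_minus" for n
      using z(1) unfolding I_def by (metis (mono_tags, lifting) mem_Collect_eq power_Suc mult.assoc)
  qed
  have zR: "z \<in> F_minus" "z * c \<in> F_minus" using z zc by (auto simp: I_def)
  obtain q where q: "q \<in> F_minus" and qe: "z * c - q * z = 0 \<or> fls_subdegree (z * c - q * z) > fls_subdegree z"
    using F_minus_division[OF zR(2,1) z(2)] by blast
  have rem: "z * c - q * z \<in> I"
  proof -
    have "(z * c - q * z) * c ^ n \<in> F_minus" for n
    proof -
      have "z * c * c ^ n \<in> F_minus" "z * c ^ n \<in> F_minus" using zc z(1) by (auto simp: I_def)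
      then have "z * c * c ^ n - q * (z * c ^ n) \<in> F_minus" by (metis F_minus_diff F_minus_mult q)
      then show ?thesis by (simp add: algebra_simps)
    qed
    moreover have "z * c - q * z \<in> F_minus" using F_minus_diff[OF zR(2) F_minus_mult[OF q zR(1)]] .
    ultimately show ?thesis by (simp add: I_def)
  qed
  have "z * c - q * z = 0"
  proof (rule ccontr)
    assume "z * c - q * z \<noteq> 0"
    with min[OF rem] qe F_minus_subdegree[of "z * c - q * z"] rem
    show False by (auto simp: I_def)
  qed
  then have "z * (c - q) = 0" by (simp add: algebra_simps)
  with z q show ?thesis by (simp add: c_def)
qed

text \<open>The inverse of \<open>f\<close> has a factor map of its own, with integral values by \<open>factor_F_minus\<close>, and it inverts
the factor map of \<open>f\<close>.\<close>

lemma factor_surj: "factor ` F_minus = F_minus"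
proof
  show "factor ` F_minus \<subseteq> F_minus" using factor_F_minus by blast
  interpret inv: commutator_map r k field_type W V "inv_into V f" by (rule inverse_commutator_map)
  show "F_minus \<subseteq> factor ` F_minus"
  proof
    fix m :: "'a fls" assume m: "m \<in> F_minus"
    define l where "l = inv.factor m"
    have l: "l \<in> F_minus" unfolding l_def by (rule inv.factor_F_minus[OF m])
    obtain w where w: "w \<in> W" "w \<noteq> 0" "m ^ r * w \<in> W"
      by (rule finite_coindex_multiplier[OF W, of "{m ^ r}"]) (use m in \<open>auto intro: F_minus_power\<close>)
    have f: "f (inv_into V f y) = y" if "y \<in> W" for y
      using that bij by (auto simp: bij_betw_def f_inv_into_f)
    have eq: "inv_into V f (m ^ r * w) = l ^ r * inv_into V f w"
      unfolding l_def by (rule inv.f_semilinear[OF m w(1,3)])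
    have "m ^ r * w = f (l ^ r * inv_into V f w)" using f[OF w(3)] eq by simp
    also have "\<dots> = factor l ^ r * w"
      using inv.f_in_W[OF w(1)] inv.f_in_W[OF w(3)] eq l by (simp add: f_semilinear f w)
    finally have "m = factor l" using w(2) by (simp add: frobenius_inj)
    with l show "m \<in> factor ` F_minus" by blast
  qed
qed

lemma multiplier_denominator: "\<exists>b\<in>F_minus. b \<noteq> 0 \<and> extension 1 * b \<in> F_minus"
proof -
  obtain x where x: "x \<in> V" "x \<noteq> 0" by (rule finite_coindex_multiplier[OF V, of "{}"]) auto
  with f_F_minus[OF x(1)] show ?thesis
    by (intro bexI[of _ "factor x"]) (auto simp: f_eq_factor factor_eq_0_iff V_F_minus factor_F_minus)
qed

end

section \<open>Ring automorphisms of the polynomial subring\<close>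

definition map_coeffs :: "('a::zero \<Rightarrow> 'a) \<Rightarrow> 'a fls \<Rightarrow> 'a fls" where
  "map_coeffs \<sigma> f = Abs_fls (\<lambda>n. \<sigma> (f $$ n))"

lemma map_coeffs_nth: "\<sigma> 0 = 0 \<Longrightarrow> map_coeffs \<sigma> f $$ n = \<sigma> (f $$ n)"
  unfolding map_coeffs_def by (rule nth_Abs_fls_lower_bound[of "fls_subdegree f"]) auto

lemma field_automorphism_0: "field_automorphism \<sigma> \<Longrightarrow> \<sigma> 0 = 0"
  unfolding field_automorphism_def by (metis add_cancel_left_right)

lemma field_automorphism_eq_0_iff: "field_automorphism \<sigma> \<Longrightarrow> \<sigma> x = 0 \<longleftrightarrow> x = 0"
  using field_automorphism_0[of \<sigma>] unfolding field_automorphism_def by (metis bij_pointE)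

lemma field_automorphism_sum:
  assumes "field_automorphism \<sigma>"
  shows "\<sigma> (sum g A) = (\<Sum>i\<in>A. \<sigma> (g i))"
  using assms field_automorphism_0[OF assms]
  by (induction A rule: infinite_finite_induct) (auto simp: field_automorphism_def)

lemma field_automorphism_power: "field_automorphism \<tau> \<Longrightarrow> \<tau> (x ^ n) = \<tau> x ^ n"
  by (induction n) (auto simp: field_automorphism_def)

lemma galois_over_prime_field_iff: "galois_over_prime_field \<sigma> \<longleftrightarrow> field_automorphism \<sigma>"
proof
  assume \<sigma>: "field_automorphism \<sigma>"
  have nat: "\<sigma> (of_nat n) = of_nat n" for n
    using \<sigma> field_automorphism_0[OF \<sigma>] by (induction n) (auto simp: field_automorphism_def)
  have "\<sigma> (- x) = - \<sigma> x" for x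
    using \<sigma> field_automorphism_0[OF \<sigma>] unfolding field_automorphism_def
    by (metis add.right_inverse add_eq_0_iff)
  then have "\<sigma> (of_int k) = of_int k" for k
    by (cases k rule: int_cases2) (simp_all add: nat)
  with \<sigma> show "galois_over_prime_field \<sigma>" by (simp add: galois_over_prime_field_def)
qed (simp add: galois_over_prime_field_def)

lemma map_coeffs_subdegree:
  assumes "field_automorphism \<sigma>"
  shows "fls_subdegree (map_coeffs \<sigma> f) = fls_subdegree f"
proof (cases "f = 0")
  case True
  then have "map_coeffs \<sigma> f = 0"
    by (intro fls_eqI) (simp add: map_coeffs_nth field_automorphism_0[OF assms])
  with True show ?thesis by simp
next
  case False
  then show ?thesis
    by (intro fls_subdegree_eqI)
      (simp_all add: map_coeffs_nth field_automorphism_0[OF assms] field_automorphism_eq_0_iff[OF assms])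
qed

lemma map_coeffs_field_automorphism:
  fixes \<sigma> :: "'a::field \<Rightarrow> 'a"
  assumes "field_automorphism \<sigma>"
  shows "field_automorphism (map_coeffs \<sigma>)"
proof -
  note \<sigma> = assms[unfolded field_automorphism_def]
  have nth: "map_coeffs \<sigma> f $$ n = \<sigma> (f $$ n)" for f n
    by (rule map_coeffs_nth) (rule field_automorphism_0[OF assms])
  have "map_coeffs \<sigma> f = map_coeffs \<sigma> g \<longleftrightarrow> f = g" for f g
    using \<sigma> unfolding fls_eq_iff nth by (metis bij_pointE)
  then have "inj (map_coeffs \<sigma>)" by (simp add: inj_def)
  moreover have "surj (map_coeffs \<sigma>)"
  proof (rule surjI)
    fix f :: "'a fls"
    have "inv_into UNIV \<sigma> 0 = 0" using field_automorphism_0[OF assms] \<sigma> by (metis bij_inv_eq_iff)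
    then show "map_coeffs \<sigma> (map_coeffs (inv_into UNIV \<sigma>) f) = f"
      using \<sigma> by (intro fls_eqI) (simp add: nth map_coeffs_nth bij_is_surj surj_f_inv_f)
  qed
  moreover have "map_coeffs \<sigma> 1 = 1"
    using \<sigma> field_automorphism_0[OF assms] by (intro fls_eqI) (simp add: nth)
  moreover have "map_coeffs \<sigma> (f + g) = map_coeffs \<sigma> f + map_coeffs \<sigma> g" for f g
    using \<sigma> by (intro fls_eqI) (simp add: nth)
  moreover have "map_coeffs \<sigma> (f * g) = map_coeffs \<sigma> f * map_coeffs \<sigma> g" for f g
    using \<sigma> by (intro fls_eqI)
      (simp add: nth fls_times_nth(2) map_coeffs_subdegree[OF assms] field_automorphism_sum[OF assms])
  ultimately show ?thesis by (simp add: field_automorphism_def bij_def)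
qed

text \<open>The substituted series has order one and so is invertible under composition.\<close>

lemma affine_subst_field_automorphism:
  fixes \<alpha> \<beta> :: "'a::field"
  assumes "\<alpha> \<noteq> 0"
  shows "field_automorphism (affine_subst \<alpha> \<beta>)" (is ?automorphism)
    and "fls_subdegree (affine_subst \<alpha> \<beta> f) = fls_subdegree f" (is ?subdegree)
    and "affine_subst \<alpha> \<beta> (fls_const c) = fls_const c" (is ?const)
proof -
  let ?s = "inverse (fls_const \<alpha> * fls_X_inv + fls_const \<beta>)"
  define G where "G = fls_regpart ?s"
  have "fps_to_fls G = ?s" "fls_subdegree ?s = 1" using subst_series[OF assms, of \<beta>] by (simp_all add: G_def)
  then have G1: "subdegree G = 1" using fls_subdegree_fls_to_fps[of G] by simp
  then have G0: "G \<noteq> 0" by auto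
  have Gn0: "fps_nth G 0 = 0" by (rule nth_less_subdegree_zero) (simp only: G1 zero_less_one)
  have Gn1: "fps_nth G 1 \<noteq> 0" using nth_subdegree_nonzero[OF G0] by (simp only: G1 not_False_eq_True)
  note G = G0 Gn0 Gn1
  have subst: "affine_subst \<alpha> \<beta> f = fls_compose_fps f G" for f by (simp add: affine_subst_def G_def)
  have inv0: "fps_nth (fps_inv G) 0 = 0" by (simp add: fps_inv_def)
  have comp: "fps_compose (fps_inv G) G = fps_X" by (rule fps_inv) (use G in auto)
  then have invn0: "fps_inv G \<noteq> 0" by (metis fps_X_neq_zero fps_compose_0)
  have X: "fls_compose_fps f fps_X = f" for f :: "'a fls"
    using fls_nth_fls_compose_fps_linear[of 1 f] by (intro fls_eqI) simp
  have "fls_compose_fps f G = fls_compose_fps g G \<longleftrightarrow> f = g" for f g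
    using fls_compose_fps_eq_0_iff[OF G(1,2), of "f - g"] by (simp add: fls_compose_fps_diff[OF G(1,2)])
  then have "inj (affine_subst \<alpha> \<beta>)" by (simp add: inj_def subst)
  moreover have "surj (affine_subst \<alpha> \<beta>)"
    by (rule surjI[of _ "\<lambda>f. fls_compose_fps f (fps_inv G)"])
      (simp add: subst fls_compose_fps_assoc[OF invn0 inv0 G(1,2)] comp X)
  ultimately show ?automorphism
    by (simp add: field_automorphism_def bij_def subst fls_compose_fps_add G fls_compose_fps_mult)
  show ?subdegree by (simp add: subst G G1)
  show ?const by (simp add: subst)
qed

lemma dist_eq_of_subdegree_eq:
  fixes \<tau> :: "'a::field fls \<Rightarrow> 'a fls"
  assumes "\<And>f g. \<tau> (f - g) = \<tau> f - \<tau> g" "\<And>f. fls_subdegree (\<tau> f) = fls_subdegree f" "inj \<tau>"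
  shows "dist (\<tau> f) (\<tau> g) = dist f g"
  using assms(2)[of "f - g"] assms(3) by (simp add: dist_fls_def inj_eq flip: assms(1))

lemma F_minus_subdegree_0: "f \<in> F_minus \<Longrightarrow> fls_subdegree f = 0 \<Longrightarrow> f = fls_const (f $$ 0)"
  by (intro fls_eqI) (metis F_minus_nth fls_const_nth fls_eq0_below_subdegree linorder_neqE)

text \<open>Such a map is determined by its values on the constants and at \<open>t\<^sup>-\<^sup>1\<close>, which are computed below.\<close>

locale F_minus_automorphism =
  fixes h :: "'a::{field,finite} fls \<Rightarrow> 'a fls"
  assumes surj: "h ` F_minus = F_minus" and inj: "inj_on h F_minus" and one: "h 1 = 1"
    and add: "\<And>x y. x \<in> F_minus \<Longrightarrow> y \<in> F_minus \<Longrightarrow> h (x + y) = h x + h y"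
    and mult: "\<And>x y. x \<in> F_minus \<Longrightarrow> y \<in> F_minus \<Longrightarrow> h (x * y) = h x * h y"
begin

lemma closed: "x \<in> F_minus \<Longrightarrow> h x \<in> F_minus" using surj by blast

lemma zero: "h 0 = 0" using add[of 0 0] by (metis F_minus_0 add_cancel_right_right add_0_right)

lemma eq_0_iff: "x \<in> F_minus \<Longrightarrow> h x = 0 \<longleftrightarrow> x = 0"
  using inj_on_eq_iff[OF inj, of x 0] by (simp add: zero)

definition \<sigma> :: "'a \<Rightarrow> 'a" where "\<sigma> c = h (fls_const c) $$ 0"

text \<open>Nonzero constants are the units of the polynomial ring.\<close>

lemma const: "h (fls_const c) = fls_const (\<sigma> c)"
proof (cases "c = 0")
  case False
  have "h (fls_const c) * h (fls_const (inverse c)) = 1"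
    using False by (simp add: one flip: mult)
  then have "fls_subdegree (h (fls_const c) * h (fls_const (inverse c))) = 0" by simp
  then have "fls_subdegree (h (fls_const c)) + fls_subdegree (h (fls_const (inverse c))) = 0"
    using False by (subst (asm) fls_subdegree_mult) (simp_all add: eq_0_iff)
  moreover have "fls_subdegree (h (fls_const c)) \<le> 0" "fls_subdegree (h (fls_const (inverse c))) \<le> 0"
    by (simp_all add: F_minus_subdegree closed)
  ultimately have "fls_subdegree (h (fls_const c)) = 0" by linarith
  then show ?thesis unfolding \<sigma>_def by (intro F_minus_subdegree_0 closed) auto
qed (simp add: zero \<sigma>_def)

lemma field_automorphism_\<sigma>: "field_automorphism \<sigma>"
proof -
  have "fls_const (\<sigma> (x + y)) = fls_const (\<sigma> x + \<sigma> y)" for x y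
    by (simp add: add flip: const fls_plus_const)
  moreover have "fls_const (\<sigma> (x * y)) = fls_const (\<sigma> x * \<sigma> y)" for x y
    by (simp add: mult flip: const fls_const_mult_const)
  moreover have "fls_const (\<sigma> 1) = fls_const 1" by (simp add: one flip: const)
  moreover have "inj \<sigma>"
  proof (rule injI)
    fix x y assume "\<sigma> x = \<sigma> y"
    then have "h (fls_const x) = h (fls_const y)" by (simp add: const)
    then have "fls_const x = fls_const y" using inj by (auto dest: inj_onD)
    then show "x = y" by (metis fls_const_nth)
  qed
  moreover from this have "surj \<sigma>" by (simp add: finite_UNIV_inj_surj)
  ultimately show ?thesis unfolding field_automorphism_def bij_def by (metis fls_const_nth)
qed

text \<open>Composition with a polynomial of positive degree multiplies degrees.\<close>

lemma subdegree_image: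
  assumes T: "fls_subdegree (h fls_X_inv) < 0" and "g \<in> F_minus"
  shows "fls_subdegree (h g) = - fls_subdegree g * fls_subdegree (h fls_X_inv)"
  using assms(2)
proof (induction g rule: F_minus_induct)
  case (X_inv c g)
  let ?d = "fls_subdegree (h fls_X_inv)"
  have hg: "h g \<noteq> 0" using X_inv eq_0_iff by simp
  have g: "fls_subdegree g \<le> 0" by (rule F_minus_subdegree) fact
  have const_add: "fls_subdegree (fls_const a + f) = fls_subdegree f" if "fls_subdegree f < 0" for a and f :: "'a fls"
    using that by (cases "a = 0") (auto intro!: fls_subdegree_add_eq2)
  have "h (fls_const c + fls_X_inv * g) = fls_const (\<sigma> c) + h fls_X_inv * h g"
    using X_inv by (simp add: add mult const F_minus_mult)
  moreover have hXg: "fls_subdegree (h fls_X_inv * h g) = ?d - fls_subdegree g * ?d"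
    using T hg X_inv.IH by (subst fls_subdegree_mult) auto
  moreover have "- fls_subdegree g * ?d \<le> 0" using T g by (intro mult_nonneg_nonpos) auto
  then have "fls_subdegree (h fls_X_inv * h g) < 0" using T unfolding hXg by linarith
  ultimately have "fls_subdegree (h (fls_const c + fls_X_inv * g)) = ?d - fls_subdegree g * ?d"
    using const_add[of "h fls_X_inv * h g" "\<sigma> c"] by simp
  moreover have "fls_subdegree (fls_const c + fls_X_inv * g) = fls_subdegree g - 1"
    using X_inv g by (subst const_add) auto
  ultimately show ?case by (simp add: left_diff_distrib)
qed (simp add: const)

text \<open>Surjectivity forces the image of \<open>t\<^sup>-\<^sup>1\<close> to have degree one.\<close>

lemma X_inv_image: "\<exists>\<alpha> \<beta>. \<alpha> \<noteq> 0 \<and> h fls_X_inv = fls_const \<alpha> * fls_X_inv + fls_const \<beta>"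
proof -
  let ?T = "h fls_X_inv"
  have TR: "?T \<in> F_minus" by (simp add: closed)
  obtain g where g: "g \<in> F_minus" "h g = fls_X_inv" using surj by (metis F_minus_X_inv imageE)
  have "fls_subdegree ?T \<noteq> 0"
  proof
    assume "fls_subdegree ?T = 0"
    then obtain b where b: "?T = fls_const b" using F_minus_subdegree_0[OF TR] by metis
    have "\<exists>c. h g = fls_const c" using g(1)
    proof (induction g rule: F_minus_induct)
      case (X_inv c g)
      then obtain a where "h g = fls_const a" by blast
      then have "h (fls_const c + fls_X_inv * g) = fls_const (\<sigma> c + b * a)"
        using X_inv by (simp add: add mult const F_minus_mult b fls_plus_const fls_const_mult_const)
      then show ?case ..
    qed (auto simp: const)
    then show False using g(2) by (metis fls_X_inv_subdegree fls_const_subdegree zero_neq_neg_one)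
  qed
  then have neg: "fls_subdegree ?T < 0" using F_minus_subdegree[OF TR] by linarith
  have "fls_subdegree g * fls_subdegree ?T = 1"
    using subdegree_image[OF neg g(1)] g(2) by simp
  then have T: "fls_subdegree ?T = - 1" using neg by (auto simp: zmult_eq_1_iff)
  then have "?T $$ (- 1) \<noteq> 0" by (metis fls_zero_subdegree nth_fls_subdegree_nonzero zero_neq_neg_one)
  moreover have "?T = fls_const (?T $$ (- 1)) * fls_X_inv + fls_const (?T $$ 0)"
  proof (rule fls_eqI)
    fix n :: int
    consider "n < - 1" | "n = - 1" | "n = 0" | "n > 0" by linarith
    then show "?T $$ n = (fls_const (?T $$ (- 1)) * fls_X_inv + fls_const (?T $$ 0)) $$ n"
      by cases (use T F_minus_nth[OF TR] in auto)
  qed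
  ultimately show ?thesis by blast
qed

text \<open>In the definition of a standard automorphism the coefficient automorphism is applied after the
substitution, so the parameters of the substitution are the preimages under \<open>\<sigma>\<close> of the coefficients of
the image of \<open>t\<^sup>-\<^sup>1\<close>.  Both maps preserve the order of a series, so the extension is an isometry.\<close>

lemma extends_to_standard:
  obtains \<tau> where "field_automorphism \<tau>" "continuous_on UNIV \<tau>" "\<And>x. x \<in> F_minus \<Longrightarrow> \<tau> x = h x"
    "\<exists>\<sigma> \<alpha> \<beta>. galois_over_prime_field \<sigma> \<and> \<alpha> \<noteq> 0 \<and>
        (\<forall>f n. fls_nth (\<tau> f) n = \<sigma> (fls_nth (affine_subst \<alpha> \<beta> f) n))"
proof -
  obtain \<alpha>' \<beta>' where T: "\<alpha>' \<noteq> 0" "h fls_X_inv = fls_const \<alpha>' * fls_X_inv + fls_const \<beta>'"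
    using X_inv_image by blast
  note \<sigma> = field_automorphism_\<sigma>
  obtain \<alpha> \<beta> where \<alpha>: "\<sigma> \<alpha> = \<alpha>'" "\<sigma> \<beta> = \<beta>'"
    using \<sigma> unfolding field_automorphism_def by (metis bij_pointE)
  have \<sigma>0: "\<sigma> 0 = 0" by (rule field_automorphism_0[OF \<sigma>])
  with \<alpha> T have \<alpha>0: "\<alpha> \<noteq> 0" by auto
  define \<tau> where "\<tau> f = map_coeffs \<sigma> (affine_subst \<alpha> \<beta> f)" for f
  note S = affine_subst_field_automorphism[OF \<alpha>0, of \<beta>]
  note M = map_coeffs_field_automorphism[OF \<sigma>]
  have auto: "field_automorphism \<tau>"
    using S(1) M unfolding field_automorphism_def \<tau>_def
    by (auto intro: bij_comp[of "affine_subst \<alpha> \<beta>" "map_coeffs \<sigma>", unfolded comp_def])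
  have "\<tau> (f - g) = \<tau> f - \<tau> g" for f g
    using auto unfolding field_automorphism_def by (metis add_diff_cancel_right' diff_add_cancel)
  moreover have "fls_subdegree (\<tau> f) = fls_subdegree f" for f
    by (simp add: \<tau>_def map_coeffs_subdegree[OF \<sigma>] S(2))
  moreover have "inj \<tau>" using auto by (simp add: field_automorphism_def bij_def)
  ultimately have dist: "dist (\<tau> f) (\<tau> g) = dist f g" for f g
    by (rule dist_eq_of_subdegree_eq)
  have mc: "map_coeffs \<sigma> (fls_const c) = fls_const (\<sigma> c)" for c
    by (intro fls_eqI) (simp add: map_coeffs_nth \<sigma>0)
  have \<tau>c: "\<tau> (fls_const c) = fls_const (\<sigma> c)" for c
    by (simp add: \<tau>_def S(3) mc)
  have "\<tau> fls_X_inv = map_coeffs \<sigma> (fls_const \<alpha> * fls_X_inv + fls_const \<beta>)"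
    by (simp add: \<tau>_def affine_subst_X_inv[OF \<alpha>0])
  also have "\<dots> = h fls_X_inv"
    unfolding T by (intro fls_eqI) (auto simp: map_coeffs_nth[of \<sigma>] \<alpha> \<sigma>0)
  finally have \<tau>X: "\<tau> fls_X_inv = h fls_X_inv" .
  show thesis
  proof (rule that[OF auto])
    show "continuous_on UNIV \<tau>" unfolding continuous_on_iff using dist by auto
    show "\<tau> x = h x" if "x \<in> F_minus" for x
      using that
    proof (induction x rule: F_minus_induct)
      case (X_inv c g)
      then show ?case
        using auto by (simp add: field_automorphism_def add mult F_minus_mult const \<tau>c \<tau>X)
    qed (simp add: const \<tau>c)
    show "\<exists>\<sigma> \<alpha> \<beta>. galois_over_prime_field \<sigma> \<and> \<alpha> \<noteq> 0 \<and>
        (\<forall>f n. fls_nth (\<tau> f) n = \<sigma> (fls_nth (affine_subst \<alpha> \<beta> f) n))"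
      using \<sigma> \<alpha>0 galois_over_prime_field_iff by (metis \<tau>_def map_coeffs_nth \<sigma>0)
  qed
qed

end

section \<open>Subgroups of finite index in an abstract group\<close>

text \<open>Finite index of \<open>H\<close> in \<open>K\<close>, where both are subsets of one ambient group \<open>G\<close>.  As for \<open>finite_coindex\<close>,
colourings make pullbacks and intersections immediate; \<open>finite_rcosets_iff_finite_mod\<close> gives the usual
notion.\<close>

definition finite_mod :: "('g, 'm) monoid_scheme \<Rightarrow> 'g set \<Rightarrow> 'g set \<Rightarrow> bool" where
  "finite_mod G H K \<longleftrightarrow> (\<exists>c :: 'g \<Rightarrow> nat. finite (c ` K) \<and>
     (\<forall>x\<in>K. \<forall>y\<in>K. c x = c y \<longrightarrow> x \<otimes>\<^bsub>G\<^esub> inv\<^bsub>G\<^esub> y \<in> H))"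

lemma finite_modI:
  fixes c :: "'g \<Rightarrow> 'c"
  assumes "finite (c ` K)"
    and "\<And>x y. x \<in> K \<Longrightarrow> y \<in> K \<Longrightarrow> c x = c y \<Longrightarrow> x \<otimes>\<^bsub>G\<^esub> inv\<^bsub>G\<^esub> y \<in> H"
  shows "finite_mod G H K"
proof -
  obtain d :: "'g \<Rightarrow> nat" where "finite (d ` K)" "\<And>x y. x \<in> K \<Longrightarrow> y \<in> K \<Longrightarrow> d x = d y \<Longrightarrow> c x = c y"
    using finite_colouring_nat[OF assms(1)] by metis
  with assms(2) show ?thesis unfolding finite_mod_def by blast
qed

lemma finite_modE:
  assumes "finite_mod G H K"
  obtains c :: "'g \<Rightarrow> nat" where "finite (c ` K)"
    "\<And>x y. x \<in> K \<Longrightarrow> y \<in> K \<Longrightarrow> c x = c y \<Longrightarrow> x \<otimes>\<^bsub>G\<^esub> inv\<^bsub>G\<^esub> y \<in> H"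
  using assms unfolding finite_mod_def by blast

lemma finite_mod_mono: "finite_mod G H K \<Longrightarrow> K' \<subseteq> K \<Longrightarrow> H \<subseteq> H' \<Longrightarrow> finite_mod G H' K'"
  unfolding finite_mod_def by (meson finite_subset image_mono subset_iff)

lemma finite_mod_Int:
  assumes "finite_mod G H K" "finite_mod G H' K"
  shows "finite_mod G (H \<inter> H') K"
proof -
  obtain c :: "'a \<Rightarrow> nat" where c: "finite (c ` K)"
    "\<And>x y. x \<in> K \<Longrightarrow> y \<in> K \<Longrightarrow> c x = c y \<Longrightarrow> x \<otimes>\<^bsub>G\<^esub> inv\<^bsub>G\<^esub> y \<in> H"
    using assms(1) finite_modE by metis
  obtain c' :: "'a \<Rightarrow> nat" where c': "finite (c' ` K)"
    "\<And>x y. x \<in> K \<Longrightarrow> y \<in> K \<Longrightarrow> c' x = c' y \<Longrightarrow> x \<otimes>\<^bsub>G\<^esub> inv\<^bsub>G\<^esub> y \<in> H'"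
    using assms(2) finite_modE by metis
  show ?thesis
  proof (rule finite_modI[of "\<lambda>x. (c x, c' x)"])
    have "(\<lambda>x. (c x, c' x)) ` K \<subseteq> c ` K \<times> c' ` K" by blast
    then show "finite ((\<lambda>x. (c x, c' x)) ` K)" by (rule finite_subset) (use c c' in simp)
  qed (use c c' in simp)
qed

context group
begin

lemma subgroup_divI:
  assumes "H \<subseteq> carrier G" "H \<noteq> {}" and div: "\<And>x y. x \<in> H \<Longrightarrow> y \<in> H \<Longrightarrow> x \<otimes> inv y \<in> H"
  shows "subgroup H G"
proof (rule subgroupI[OF assms(1,2)])
  obtain x where x: "x \<in> H" using assms(2) by blast
  then have one: "\<one> \<in> H" using div[OF x x] assms(1) by auto
  show inv: "inv a \<in> H" if "a \<in> H" for a using div[OF one that] that assms(1) by auto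
  show "a \<otimes> b \<in> H" if "a \<in> H" "b \<in> H" for a b
    using div[OF that(1) inv[OF that(2)]] that assms(1) by auto
qed

lemma subgroup_div: "subgroup H G \<Longrightarrow> x \<in> H \<Longrightarrow> y \<in> H \<Longrightarrow> x \<otimes> inv y \<in> H"
  by (simp add: subgroup.m_closed subgroup.m_inv_closed)

lemma hom_div:
  assumes "subgroup K G" "\<And>x. x \<in> K \<Longrightarrow> h x \<in> carrier G"
    "\<And>x y. x \<in> K \<Longrightarrow> y \<in> K \<Longrightarrow> h (x \<otimes> y) = h x \<otimes> h y" "x \<in> K" "y \<in> K"
  shows "h (x \<otimes> inv y) = h x \<otimes> inv (h y)"
proof -
  have K: "K \<subseteq> carrier G" by (rule subgroup.subset[OF assms(1)])
  have xy: "x \<otimes> inv y \<in> K" by (rule subgroup_div) fact+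
  have "h (x \<otimes> inv y) \<otimes> h y = h (x \<otimes> inv y \<otimes> y)" by (simp add: assms(3)[OF xy assms(5)])
  also have "x \<otimes> inv y \<otimes> y = x" using assms(4,5) K by (simp add: m_assoc subset_iff)
  finally show ?thesis using assms(2)[OF xy] assms(2)[OF assms(5)] assms(2)[OF assms(4)]
    by (metis inv_solve_right)
qed

lemma subgroup_vimage:
  assumes "subgroup K G" "subgroup H G" "\<And>x. x \<in> K \<Longrightarrow> h x \<in> carrier G"
    "\<And>x y. x \<in> K \<Longrightarrow> y \<in> K \<Longrightarrow> h (x \<otimes> y) = h x \<otimes> h y"
  shows "subgroup {x \<in> K. h x \<in> H} G"
proof (rule subgroup_divI)
  show "{x \<in> K. h x \<in> H} \<subseteq> carrier G" using subgroup.subset[OF assms(1)] by blast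
  have one: "\<one> \<in> K" by (rule subgroup.one_closed[OF assms(1)])
  have "h (\<one> \<otimes> inv \<one>) = h \<one> \<otimes> inv (h \<one>)" by (rule hom_div) (use assms one in auto)
  then have "h \<one> = \<one>" using assms(3)[OF one] by simp
  then show "{x \<in> K. h x \<in> H} \<noteq> {}" using one subgroup.one_closed[OF assms(2)] by auto
  show "x \<otimes> inv y \<in> {x \<in> K. h x \<in> H}" if "x \<in> {x \<in> K. h x \<in> H}" "y \<in> {x \<in> K. h x \<in> H}" for x y
    using that hom_div[OF assms(1,3,4), of x y] subgroup_div[OF assms(1), of x y]
      subgroup_div[OF assms(2), of "h x" "h y"] by auto
qed

lemma subgroup_image:
  assumes "subgroup K G" "\<And>x. x \<in> K \<Longrightarrow> h x \<in> carrier G"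
    "\<And>x y. x \<in> K \<Longrightarrow> y \<in> K \<Longrightarrow> h (x \<otimes> y) = h x \<otimes> h y"
  shows "subgroup (h ` K) G"
proof (rule subgroup_divI)
  show "h ` K \<noteq> {}" using subgroup.one_closed[OF assms(1)] by blast
  show "h ` K \<subseteq> carrier G" using assms(2) by blast
  fix x y assume "x \<in> h ` K" "y \<in> h ` K"
  then obtain a b where ab: "a \<in> K" "b \<in> K" "x = h a" "y = h b" by blast
  have "h (a \<otimes> inv b) = x \<otimes> inv y" unfolding ab(3,4) by (rule hom_div) (use assms ab in auto)
  then show "x \<otimes> inv y \<in> h ` K" using subgroup_div[OF assms(1) ab(1,2)] by (metis imageI)
qed

lemma finite_rcosets_iff_finite_mod:
  assumes H: "subgroup H G" and K: "subgroup K G" "H \<subseteq> K"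
  shows "finite (rcosets\<^bsub>G\<lparr>carrier := K\<rparr>\<^esub> H) \<longleftrightarrow> finite_mod G H K"
proof -
  have sub: "K \<subseteq> carrier G" by (rule subgroup.subset[OF K(1)])
  have HG: "H \<subseteq> carrier G" by (rule subgroup.subset[OF H])
  have eq: "rcosets\<^bsub>G\<lparr>carrier := K\<rparr>\<^esub> H = (\<lambda>x. H #> x) ` K"
    by (auto simp: RCOSETS_def r_coset_def)
  have coset: "H #> x = H #> y \<longleftrightarrow> x \<otimes> inv y \<in> H" if "x \<in> K" "y \<in> K" for x y
  proof -
    have xy: "x \<in> carrier G" "y \<in> carrier G" using that sub by auto
    have z: "x \<otimes> inv y \<in> carrier G" using xy by simp
    show ?thesis
    proof
      assume "H #> x = H #> y"
      then have "H #> (x \<otimes> inv y) = H" by (rule coset_mult_inv2[OF _ xy HG])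
      then show "x \<otimes> inv y \<in> H" by (rule coset_join1[OF _ z H])
    next
      assume "x \<otimes> inv y \<in> H"
      then have "H #> (x \<otimes> inv y) = H" by (rule coset_join2[OF z H])
      then show "H #> x = H #> y" by (rule coset_mult_inv1[OF _ xy HG])
    qed
  qed
  show ?thesis
  proof
    assume "finite (rcosets\<^bsub>G\<lparr>carrier := K\<rparr>\<^esub> H)"
    then show "finite_mod G H K"
      unfolding eq by (rule finite_modI) (simp add: coset)
  next
    assume "finite_mod G H K"
    then obtain c :: "'a \<Rightarrow> nat" where c: "finite (c ` K)"
      "\<And>x y. x \<in> K \<Longrightarrow> y \<in> K \<Longrightarrow> c x = c y \<Longrightarrow> x \<otimes> inv y \<in> H"
      by (rule finite_modE) blast
    have "(\<lambda>x. H #> x) ` K \<subseteq> (\<lambda>n. H #> inv_into K c n) ` c ` K"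
    proof
      fix X assume "X \<in> (\<lambda>x. H #> x) ` K"
      then obtain x where x: "x \<in> K" "X = H #> x" by blast
      have "H #> x = H #> inv_into K c (c x)"
        using x c(2) by (simp add: coset inv_into_into f_inv_into_f)
      with x show "X \<in> (\<lambda>n. H #> inv_into K c n) ` c ` K" by blast
    qed
    then show "finite (rcosets\<^bsub>G\<lparr>carrier := K\<rparr>\<^esub> H)"
      unfolding eq using c(1) by (meson finite_imageI finite_subset)
  qed
qed

text \<open>Refine the colour of \<open>x\<close> by the colour of \<open>x \<rho>\<^sup>-\<^sup>1\<close> in \<open>H\<close>, where \<open>\<rho>\<close> is a chosen element with the same
colour as \<open>x\<close>.\<close>

lemma finite_mod_trans:
  assumes K: "K \<subseteq> carrier G" and "H \<subseteq> carrier G" "finite_mod G H K" "finite_mod G J H"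
  shows "finite_mod G J K"
proof -
  obtain c :: "'a \<Rightarrow> nat" where c: "finite (c ` K)"
    "\<And>x y. x \<in> K \<Longrightarrow> y \<in> K \<Longrightarrow> c x = c y \<Longrightarrow> x \<otimes> inv y \<in> H"
    using finite_modE[OF assms(3)] by metis
  obtain d :: "'a \<Rightarrow> nat" where d: "finite (d ` H)"
    "\<And>x y. x \<in> H \<Longrightarrow> y \<in> H \<Longrightarrow> d x = d y \<Longrightarrow> x \<otimes> inv y \<in> J"
    using finite_modE[OF assms(4)] by metis
  define \<rho> where "\<rho> x = inv_into K c (c x)" for x
  have \<rho>: "\<rho> x \<in> K" "x \<otimes> inv \<rho> x \<in> H" if "x \<in> K" for x
    using that c(2) by (auto simp: \<rho>_def inv_into_into f_inv_into_f)
  show ?thesis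
  proof (rule finite_modI[of "\<lambda>x. (c x, d (x \<otimes> inv \<rho> x))"])
    have "(\<lambda>x. (c x, d (x \<otimes> inv \<rho> x))) ` K \<subseteq> c ` K \<times> d ` H" using \<rho> by blast
    then show "finite ((\<lambda>x. (c x, d (x \<otimes> inv \<rho> x))) ` K)" by (rule finite_subset) (use c d in simp)
    fix x y assume xy: "x \<in> K" "y \<in> K" "(c x, d (x \<otimes> inv \<rho> x)) = (c y, d (y \<otimes> inv \<rho> y))"
    then have same: "\<rho> x = \<rho> y" by (simp add: \<rho>_def)
    have "x \<otimes> inv \<rho> x \<otimes> inv (y \<otimes> inv \<rho> y) \<in> J" using xy by (intro d \<rho>) auto
    moreover have "x \<otimes> inv \<rho> x \<otimes> inv (y \<otimes> inv \<rho> y) = x \<otimes> inv y"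
    proof -
      have xyG: "x \<in> carrier G" "y \<in> carrier G" "\<rho> y \<in> carrier G" using xy K \<rho> by auto
      then have "x \<otimes> inv \<rho> y \<otimes> inv (y \<otimes> inv \<rho> y) = x \<otimes> (inv \<rho> y \<otimes> (\<rho> y \<otimes> inv y))"
        by (simp add: inv_mult_group m_assoc)
      also have "inv \<rho> y \<otimes> (\<rho> y \<otimes> inv y) = inv y" using xyG by (simp flip: m_assoc)
      finally show ?thesis by (simp add: same)
    qed
    ultimately show "x \<otimes> inv y \<in> J" by simp
  qed
qed

lemma finite_mod_vimage:
  assumes "subgroup K G" "\<And>x. x \<in> K \<Longrightarrow> h x \<in> K'" "K' \<subseteq> carrier G"
    "\<And>x y. x \<in> K \<Longrightarrow> y \<in> K \<Longrightarrow> h (x \<otimes> y) = h x \<otimes> h y" "finite_mod G H K'"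
  shows "finite_mod G {x \<in> K. h x \<in> H} K"
proof -
  obtain c :: "'a \<Rightarrow> nat" where c: "finite (c ` K')"
    "\<And>x y. x \<in> K' \<Longrightarrow> y \<in> K' \<Longrightarrow> c x = c y \<Longrightarrow> x \<otimes> inv y \<in> H"
    using finite_modE[OF assms(5)] by metis
  show ?thesis
  proof (rule finite_modI[of "\<lambda>x. c (h x)"])
    show "finite ((\<lambda>x. c (h x)) ` K)" by (rule finite_subset[OF _ c(1)]) (use assms(2) in blast)
    fix x y assume xy: "x \<in> K" "y \<in> K" "c (h x) = c (h y)"
    have "h (x \<otimes> inv y) = h x \<otimes> inv (h y)" by (rule hom_div) (use assms xy in auto)
    with c(2)[of "h x" "h y"] xy assms(2) subgroup_div[OF assms(1)]
    show "x \<otimes> inv y \<in> {x \<in> K. h x \<in> H}" by simp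
  qed
qed

lemma finite_mod_image:
  assumes "subgroup K G" "\<And>x. x \<in> K \<Longrightarrow> h x \<in> carrier G"
    "\<And>x y. x \<in> K \<Longrightarrow> y \<in> K \<Longrightarrow> h (x \<otimes> y) = h x \<otimes> h y" "finite_mod G H K" "H \<subseteq> K"
  shows "finite_mod G (h ` H) (h ` K)"
proof -
  obtain c :: "'a \<Rightarrow> nat" where c: "finite (c ` K)"
    "\<And>x y. x \<in> K \<Longrightarrow> y \<in> K \<Longrightarrow> c x = c y \<Longrightarrow> x \<otimes> inv y \<in> H"
    using finite_modE[OF assms(4)] by metis
  show ?thesis
  proof (rule finite_modI[of "\<lambda>y. c (inv_into K h y)"])
    show "finite ((\<lambda>y. c (inv_into K h y)) ` h ` K)"
      by (rule finite_subset[OF _ c(1)]) (auto simp: inv_into_into)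
    fix x y assume xy: "x \<in> h ` K" "y \<in> h ` K" "c (inv_into K h x) = c (inv_into K h y)"
    let ?x = "inv_into K h x" and ?y = "inv_into K h y"
    have K: "?x \<in> K" "?y \<in> K" "h ?x = x" "h ?y = y"
      using xy by (auto simp: inv_into_into f_inv_into_f)
    have "h (?x \<otimes> inv ?y) = x \<otimes> inv y" using hom_div[OF assms(1-3) K(1,2)] K by simp
    moreover have "?x \<otimes> inv ?y \<in> H" by (rule c) (use K xy in auto)
    ultimately show "x \<otimes> inv y \<in> h ` H" by (metis imageI)
  qed
qed

end

section \<open>The matrix group and its virtual automorphisms\<close>

abbreviation y_coord :: "'b ^ 3 ^ 3 \<Rightarrow> 'b" where "y_coord M \<equiv> M $ 2 $ 3"

lemma G2_mat_coords [simp]: "G2_mat r y z $ 2 $ 3 = y" "G2_mat r y z $ 1 $ 3 = z"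
  by (simp_all add: G2_mat_nth)

lemma G2_mat_inject: "G2_mat r y z = G2_mat r y' z' \<longleftrightarrow> y = y' \<and> z = z'"
  by (metis G2_mat_coords)

context frobenius_power
begin

abbreviation G2 :: "('a fls ^ 3 ^ 3) monoid" where "G2 \<equiv> matrix_group (G2_set r)"

definition G2_integral :: "('a fls ^ 3 ^ 3) set" where
  "G2_integral = GL_over F_minus \<inter> G2_set r"

lemma G2_mult: "G2_mat r y z ** G2_mat r y' z' = G2_mat r (y + y') (z + z' + y ^ r * y')" for y :: "'a fls"
  by (rule G2_mat_mult[of "CHAR('a)" r k]) (use prime_CHAR r_power in auto)

sublocale G2: group G2
  by (rule group_G2[of "CHAR('a)" r k]) (use prime_CHAR r_power in auto)

lemma carrier_G2: "carrier G2 = G2_set r" and mult_G2: "M \<otimes>\<^bsub>G2\<^esub> N = M ** N"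
  by (simp_all add: matrix_group_def)

lemma G2_mat_carrier [simp]: "G2_mat r y z \<in> carrier G2" for y :: "'a fls"
  unfolding carrier_G2 by (auto simp: G2_set_def)

lemma G2_mat_cases:
  assumes "M \<in> carrier G2"
  obtains y z where "M = G2_mat r y z"
  using assms unfolding carrier_G2 by (auto simp: G2_set_def)

lemma one_G2: "\<one>\<^bsub>G2\<^esub> = G2_mat r 0 0"
proof -
  have "G2_mat r 0 0 \<otimes>\<^bsub>G2\<^esub> G2_mat r 0 0 = (G2_mat r 0 0 :: 'a fls ^ 3 ^ 3)"
    by (simp add: mult_G2 G2_mult)
  then show ?thesis using G2.one_unique[of "G2_mat r 0 0"] G2.l_cancel_one[of "G2_mat r 0 0" "G2_mat r 0 0"] by simp
qed

lemma inv_G2: "inv\<^bsub>G2\<^esub> G2_mat r y z = G2_mat r (- y) (y ^ r * y - z)" for y :: "'a fls"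
  by (rule G2.inv_equality) (simp_all add: mult_G2 G2_mult one_G2 frobenius_uminus)

lemma div_G2: "G2_mat r y z \<otimes>\<^bsub>G2\<^esub> inv\<^bsub>G2\<^esub> G2_mat r y' z' = G2_mat r (y - y') (z - z' - (y - y') ^ r * y')" for y :: "'a fls"
  by (simp add: inv_G2 mult_G2 G2_mult frobenius_diff algebra_simps)

lemma y_coord_mult: "M \<in> carrier G2 \<Longrightarrow> N \<in> carrier G2 \<Longrightarrow> y_coord (M \<otimes>\<^bsub>G2\<^esub> N) = y_coord M + y_coord N"
  by (auto elim!: G2_mat_cases simp: mult_G2 G2_mult)

lemma y_coord_div: "M \<in> carrier G2 \<Longrightarrow> N \<in> carrier G2 \<Longrightarrow> y_coord (M \<otimes>\<^bsub>G2\<^esub> inv\<^bsub>G2\<^esub> N) = y_coord M - y_coord N"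
  by (auto elim!: G2_mat_cases simp: div_G2)

lemma G2_integral_iff: "M \<in> G2_integral \<longleftrightarrow> (\<exists>y\<in>F_minus. \<exists>z\<in>F_minus. M = G2_mat r y z)"
proof
  assume "M \<in> G2_integral"
  then obtain y z where M: "M = G2_mat r y z" and "\<forall>i j. M $ i $ j \<in> F_minus"
    by (auto simp: G2_integral_def GL_over_def G2_set_def)
  then have "M $ 2 $ 3 \<in> F_minus" "M $ 1 $ 3 \<in> F_minus" by blast+
  then show "\<exists>y\<in>F_minus. \<exists>z\<in>F_minus. M = G2_mat r y z" using M by auto
next
  assume "\<exists>y\<in>F_minus. \<exists>z\<in>F_minus. M = G2_mat r y z"
  then obtain y z where yz: "y \<in> F_minus" "z \<in> F_minus" and M: "M = G2_mat r y z" by blast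
  have entries: "\<forall>i j. G2_mat r y z $ i $ j \<in> F_minus" if "y \<in> F_minus" "z \<in> F_minus" for y z :: "'a fls"
    using that by (simp add: forall_3 G2_mat_nth F_minus_power)
  have one: "mat 1 = \<one>\<^bsub>G2\<^esub>" by (simp add: matrix_group_def)
  have "M ** inv\<^bsub>G2\<^esub> M = mat 1" "inv\<^bsub>G2\<^esub> M ** M = mat 1"
    using G2.r_inv[of M] G2.l_inv[of M] by (simp_all add: M mult_G2 one)
  moreover have "\<forall>i j. (inv\<^bsub>G2\<^esub> M) $ i $ j \<in> F_minus"
    unfolding M inv_G2 by (rule entries) (use yz in \<open>auto intro!: F_minus_closed\<close>)
  ultimately show "M \<in> G2_integral"
    using entries[OF yz] by (auto simp: G2_integral_def GL_over_def G2_set_def M)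
qed

lemma G2_integral_carrier: "G2_integral \<subseteq> carrier G2"
  by (auto simp: G2_integral_iff)

lemma subgroup_G2_integral: "subgroup G2_integral G2"
proof (rule G2.subgroup_divI[OF G2_integral_carrier])
  have "G2_mat r 0 0 \<in> G2_integral" unfolding G2_integral_iff using F_minus_0 by blast
  then show "G2_integral \<noteq> {}" by blast
  show "M \<otimes>\<^bsub>G2\<^esub> inv\<^bsub>G2\<^esub> N \<in> G2_integral" if "M \<in> G2_integral" "N \<in> G2_integral" for M N
    using that by (fastforce simp: G2_integral_iff div_G2 G2_mat_inject intro!: F_minus_closed)
qed

text \<open>A colouring of \<open>G\<^sub>2(\<F>\<^sub>q[t\<^sup>-\<^sup>1])\<close> restricts to the elements with \<open>z = 0\<close>.\<close>

lemma finite_coindex_y_coords: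
  assumes A: "subgroup A G2" "A \<subseteq> G2_integral" "finite_mod G2 A G2_integral"
  shows "finite_coindex (y_coord ` A)"
proof -
  obtain c :: "'a fls ^ 3 ^ 3 \<Rightarrow> nat" where c: "finite (c ` G2_integral)"
    "\<And>M N. M \<in> G2_integral \<Longrightarrow> N \<in> G2_integral \<Longrightarrow> c M = c N \<Longrightarrow> M \<otimes>\<^bsub>G2\<^esub> inv\<^bsub>G2\<^esub> N \<in> A"
    using finite_modE[OF A(3)] by metis
  have int: "G2_mat r y 0 \<in> G2_integral" if "y \<in> F_minus" for y
    using that by (auto simp: G2_integral_iff intro: F_minus_0)
  show ?thesis
  proof (rule finite_coindexI[of _ "\<lambda>y. c (G2_mat r y 0)"])
    have "y_coord M \<in> F_minus" if "M \<in> G2_integral" for M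
      using that by (auto simp: G2_integral_iff)
    then show "y_coord ` A \<subseteq> F_minus" using A(2) by blast
    show "x - y \<in> y_coord ` A" if "x \<in> y_coord ` A" "y \<in> y_coord ` A" for x y
    proof -
      obtain M N where MN: "M \<in> A" "N \<in> A" "x = y_coord M" "y = y_coord N" using \<open>x \<in> _\<close> \<open>y \<in> _\<close> by blast
      then have "x - y = y_coord (M \<otimes>\<^bsub>G2\<^esub> inv\<^bsub>G2\<^esub> N)"
        using subgroup.subset[OF A(1)] by (subst y_coord_div) auto
      then show ?thesis using G2.subgroup_div[OF A(1) MN(1,2)] by blast
    qed
    show "finite ((\<lambda>y. c (G2_mat r y 0)) ` F_minus)"
      by (rule finite_subset[OF _ c(1)]) (use int in blast)
    show "x - y \<in> y_coord ` A" if "x \<in> F_minus" "y \<in> F_minus" "c (G2_mat r x 0) = c (G2_mat r y 0)" for x y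
      using imageI[OF c(2)[OF int[OF that(1)] int[OF that(2)] that(3)], of y_coord] by (simp add: div_G2)
  qed
qed

text \<open>This is \<open>M N M\<^sup>-\<^sup>1 N\<^sup>-\<^sup>1\<close>, written as a quotient of products so that one division rule suffices.\<close>

definition commutator :: "'a fls ^ 3 ^ 3 \<Rightarrow> 'a fls ^ 3 ^ 3 \<Rightarrow> 'a fls ^ 3 ^ 3" where
  "commutator M N = (M \<otimes>\<^bsub>G2\<^esub> N) \<otimes>\<^bsub>G2\<^esub> inv\<^bsub>G2\<^esub> (N \<otimes>\<^bsub>G2\<^esub> M)"

lemma commutator_eq:
  assumes "M \<in> carrier G2" "N \<in> carrier G2"
  shows "commutator M N = G2_mat r 0 (commutator_form r (y_coord M) (y_coord N))"
proof -
  obtain y z y' z' where "M = G2_mat r y z" "N = G2_mat r y' z'" using assms by (metis G2_mat_cases)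
  then show ?thesis
    unfolding commutator_def mult_G2[of M N] mult_G2[of N M]
    by (simp add: G2_mult div_G2 G2_mat_inject commutator_form_def algebra_simps) (use r_pos in \<open>simp add: zero_power\<close>)
qed

text \<open>If \<open>y\<^sup>r w = y w\<^sup>r\<close> holds for \<open>w\<close> and for \<open>t\<^sup>-\<^sup>1 w\<close>, then \<open>t\<^sup>-\<^sup>1\<close> is its own \<open>r\<close>-th power,
which is impossible.\<close>

lemma exists_noncommuting:
  fixes y :: "'a fls"
  assumes "finite_coindex V" "y \<noteq> 0"
  shows "\<exists>w\<in>V. commutator_form r y w \<noteq> 0"
proof (rule ccontr)
  assume "\<not> ?thesis"
  then have comm0: "y ^ r * w = y * w ^ r" if "w \<in> V" for w using that by (simp add: commutator_form_def)
  obtain w where w: "w \<in> V" "w \<noteq> 0" "fls_X_inv * w \<in> V"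
    by (rule finite_coindex_multiplier[OF assms(1), of "{fls_X_inv}"]) auto
  have "fls_X_inv * (y * w ^ r) = y * (fls_X_inv * w) ^ r"
    using comm0[OF w(1)] comm0[OF w(3)] by (metis mult.left_commute)
  then have "y * w ^ r * fls_X_inv = y * w ^ r * fls_X_inv ^ r"
    by (simp only: power_mult_distrib mult_ac)
  then have "fls_X_inv = (fls_X_inv ^ r :: 'a fls)"
    using assms(2) w(2) mult_left_cancel[of "y * w ^ r"] by (metis mult_eq_0_iff power_not_zero)
  with X_inv_not_power show False by blast
qed

text \<open>An element of \<open>A\<close> has \<open>y = 0\<close> if and only if it commutes with all of \<open>A\<close> (\<open>exists_noncommuting\<close>), and
likewise for \<open>B\<close>.  So the isomorphism preserves the condition \<open>y = 0\<close> and descends to a map \<open>f\<close> on first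
coordinates, to which the results on \<open>commutator_map\<close> apply.\<close>

lemma standard_map_on_y_coords:
  assumes A: "subgroup A G2" "A \<subseteq> G2_integral" "finite_mod G2 A G2_integral"
    and B: "subgroup B G2" "B \<subseteq> G2_integral" "finite_mod G2 B G2_integral"
    and bij: "bij_betw lam A B"
    and hom: "\<And>M N. M \<in> A \<Longrightarrow> N \<in> A \<Longrightarrow> lam (M \<otimes>\<^bsub>G2\<^esub> N) = lam M \<otimes>\<^bsub>G2\<^esub> lam N"
  obtains \<tau> a where "field_automorphism \<tau>" "continuous_on UNIV \<tau>" "a \<noteq> 0" "standard \<tau> a"
    "\<tau> ` F_minus \<subseteq> F_minus" "\<And>M. M \<in> A \<Longrightarrow> y_coord (lam M) = a * \<tau> (y_coord M)"
proof -
  define V W where "V = y_coord ` A" and "W = y_coord ` B"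
  have V: "finite_coindex V" and W: "finite_coindex W"
    unfolding V_def W_def using A B by (auto intro: finite_coindex_y_coords)
  have im: "lam ` A = B" and inj: "inj_on lam A" using bij by (auto simp: bij_betw_def)
  have AG: "M \<in> carrier G2" if "M \<in> A" for M using that subgroup.subset[OF A(1)] by blast
  have lB: "lam M \<in> B" if "M \<in> A" for M using that im by blast
  have BG: "lam M \<in> carrier G2" if "M \<in> A" for M using lB[OF that] subgroup.subset[OF B(1)] by blast
  have lam_div: "lam (M \<otimes>\<^bsub>G2\<^esub> inv\<^bsub>G2\<^esub> N) = lam M \<otimes>\<^bsub>G2\<^esub> inv\<^bsub>G2\<^esub> lam N" if "M \<in> A" "N \<in> A" for M N
    by (rule G2.hom_div[OF A(1)]) (use BG hom that in auto)
  have lam_comm: "lam (commutator M N) = commutator (lam M) (lam N)" if "M \<in> A" "N \<in> A" for M N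
  proof -
    have MN: "M \<otimes>\<^bsub>G2\<^esub> N \<in> A" "N \<otimes>\<^bsub>G2\<^esub> M \<in> A" using subgroup.m_closed[OF A(1)] that by auto
    have "lam (commutator M N) = lam (M \<otimes>\<^bsub>G2\<^esub> N) \<otimes>\<^bsub>G2\<^esub> inv\<^bsub>G2\<^esub> lam (N \<otimes>\<^bsub>G2\<^esub> M)"
      unfolding commutator_def by (rule lam_div[OF MN])
    then show ?thesis unfolding commutator_def by (simp only: hom that)
  qed
  have comm_iff: "commutator_form r (y_coord (lam M)) (y_coord (lam N)) = commutator_form r (y_coord (lam M')) (y_coord (lam N')) \<longleftrightarrow>
      commutator_form r (y_coord M) (y_coord N) = commutator_form r (y_coord M') (y_coord N')"
    if MN: "M \<in> A" "N \<in> A" "M' \<in> A" "N' \<in> A" for M N M' N'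
  proof -
    have cA: "commutator M N \<in> A" if "M \<in> A" "N \<in> A" for M N
      unfolding commutator_def using that by (intro G2.subgroup_div[OF A(1)] subgroup.m_closed[OF A(1)])
    have "commutator_form r (y_coord (lam M)) (y_coord (lam N)) = commutator_form r (y_coord (lam M')) (y_coord (lam N')) \<longleftrightarrow>
        commutator (lam M) (lam N) = commutator (lam M') (lam N')"
      using MN by (simp add: commutator_eq BG G2_mat_inject)
    also have "\<dots> \<longleftrightarrow> lam (commutator M N) = lam (commutator M' N')" using MN by (simp only: lam_comm)
    also have "\<dots> \<longleftrightarrow> commutator M N = commutator M' N'" using inj cA MN by (simp add: inj_on_eq_iff)
    also have "\<dots> \<longleftrightarrow> commutator_form r (y_coord M) (y_coord N) = commutator_form r (y_coord M') (y_coord N')"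
      using MN by (simp add: commutator_eq AG G2_mat_inject)
    finally show ?thesis .
  qed
  have comm_0: "commutator_form r 0 y = 0" for y :: "'a fls" using r_pos by (simp add: commutator_form_def zero_power)
  have noncomm: "y = 0 \<longleftrightarrow> (\<forall>M\<in>C. commutator_form r y (y_coord M) = 0)" if "finite_coindex (y_coord ` C)" for y and C :: "('a fls ^ 3 ^ 3) set"
    using exists_noncommuting[OF that, of y] comm_0 by auto
  define I where "I = (\<one>\<^bsub>G2\<^esub> :: 'a fls ^ 3 ^ 3)"
  have I: "I \<in> A" "y_coord I = 0"
    using subgroup.one_closed[OF A(1)] by (simp_all add: I_def one_G2)
  have "I \<otimes>\<^bsub>G2\<^esub> I = I" by (simp add: I_def)
  then have kernel_one: "y_coord (lam I) = y_coord (lam I) + y_coord (lam I)"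
    using y_coord_mult[OF BG[OF I(1)] BG[OF I(1)]] hom[OF I(1) I(1)] by metis
  have lI: "y_coord (lam I) = 0"
    using kernel_one by (metis add_cancel_right_right)
  have kernel: "y_coord (lam M) = 0 \<longleftrightarrow> y_coord M = 0" if M: "M \<in> A" for M
  proof -
    have "y_coord (lam M) = 0 \<longleftrightarrow> (\<forall>N\<in>A. commutator_form r (y_coord (lam M)) (y_coord (lam N)) = 0)"
      using noncomm[OF W[unfolded W_def]] im by blast
    also have "\<dots> \<longleftrightarrow> (\<forall>N\<in>A. commutator_form r (y_coord M) (y_coord N) = 0)"
      using comm_iff[OF M _ I(1) I(1)] by (simp add: I(2) lI comm_0)
    also have "\<dots> \<longleftrightarrow> y_coord M = 0" using noncomm[OF V[unfolded V_def]] by blast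
    finally show ?thesis .
  qed
  have same_y: "y_coord (lam M) = y_coord (lam N) \<longleftrightarrow> y_coord M = y_coord N" if MN: "M \<in> A" "N \<in> A" for M N
  proof -
    have "y_coord (lam (M \<otimes>\<^bsub>G2\<^esub> inv\<^bsub>G2\<^esub> N)) = y_coord (lam M) - y_coord (lam N)"
      unfolding lam_div[OF MN] using MN by (intro y_coord_div BG)
    moreover have "y_coord (M \<otimes>\<^bsub>G2\<^esub> inv\<^bsub>G2\<^esub> N) = y_coord M - y_coord N"
      using MN by (intro y_coord_div AG)
    ultimately show ?thesis using kernel[OF G2.subgroup_div[OF A(1) MN]] by simp
  qed
  define f where "f x = y_coord (lam (SOME M. M \<in> A \<and> y_coord M = x))" for x
  have f: "f (y_coord M) = y_coord (lam M)" if "M \<in> A" for M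
  proof -
    have "\<exists>N. N \<in> A \<and> y_coord N = y_coord M" using that by blast
    then have "(SOME N. N \<in> A \<and> y_coord N = y_coord M) \<in> A \<and>
        y_coord (SOME N. N \<in> A \<and> y_coord N = y_coord M) = y_coord M" by (rule someI_ex)
    then show ?thesis unfolding f_def using same_y[OF _ that] by blast
  qed
  interpret commutator_map r k field_type V W f
  proof unfold_locales
    show "bij_betw f V W"
    proof (rule bij_betw_imageI)
      show "inj_on f V" by (rule inj_onI) (auto simp: V_def f same_y)
      show "f ` V = W" unfolding V_def W_def im[symmetric] image_image by (rule image_cong) (auto simp: f)
    qed
    show "f (x + y) = f x + f y" if xy: "x \<in> V" "y \<in> V" for x y
    proof -
      obtain M N where MN: "M \<in> A" "N \<in> A" "x = y_coord M" "y = y_coord N" using xy by (auto simp: V_def)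
      have "x + y = y_coord (M \<otimes>\<^bsub>G2\<^esub> N)" using MN by (simp add: y_coord_mult AG)
      then have "f (x + y) = y_coord (lam (M \<otimes>\<^bsub>G2\<^esub> N))"
        using MN f subgroup.m_closed[OF A(1)] by metis
      also have "\<dots> = f x + f y" using MN by (simp add: hom y_coord_mult BG f)
      finally show ?thesis .
    qed
    show "commutator_form r (f x) (f y) = commutator_form r (f x') (f y') \<longleftrightarrow> commutator_form r x y = commutator_form r x' y'"
      if "x \<in> V" "y \<in> V" "x' \<in> V" "y' \<in> V" for x y x' y'
      using that unfolding V_def by (elim imageE) (simp add: f comm_iff)
  qed (rule V W)+
  interpret h: F_minus_automorphism factor
    by unfold_locales (use factor_surj inj_factor factor_1 factor_add factor_mult in auto)
  obtain \<tau> where \<tau>: "field_automorphism \<tau>" "continuous_on UNIV \<tau>" "\<And>x. x \<in> F_minus \<Longrightarrow> \<tau> x = factor x"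
    "\<exists>\<sigma> \<alpha> \<beta>. galois_over_prime_field \<sigma> \<and> \<alpha> \<noteq> 0 \<and>
        (\<forall>f n. fls_nth (\<tau> f) n = \<sigma> (fls_nth (affine_subst \<alpha> \<beta> f) n))"
    by (rule h.extends_to_standard) blast
  show thesis
  proof (rule that[OF \<tau>(1,2) extension_1_nonzero])
    show "standard \<tau> (extension 1)"
      unfolding standard_def using \<tau>(4) multiplier_denominator by blast
    show "\<tau> ` F_minus \<subseteq> F_minus" using \<tau>(3) factor_F_minus by auto
    show "y_coord (lam M) = extension 1 * \<tau> (y_coord M)" if "M \<in> A" for M
    proof -
      have "y_coord M \<in> V" using that by (simp add: V_def)
      then show ?thesis using f_eq_factor[of "y_coord M"] f[OF that] \<tau>(3) V_F_minus by simp
    qed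
  qed
qed

lemma phi_G2_closed: "M \<in> carrier G2 \<Longrightarrow> phi r \<tau> a M \<in> carrier G2"
  by (elim G2_mat_cases) (simp add: phi_G2_mat)

lemma phi_mult:
  assumes "field_automorphism \<tau>" "M \<in> carrier G2" "N \<in> carrier G2"
  shows "phi r \<tau> a (M \<otimes>\<^bsub>G2\<^esub> N) = phi r \<tau> a M \<otimes>\<^bsub>G2\<^esub> phi r \<tau> a N"
proof -
  obtain y z y' z' where MN: "M = G2_mat r y z" "N = G2_mat r y' z'" using assms(2,3) by (metis G2_mat_cases)
  have "\<tau> (x + y) = \<tau> x + \<tau> y" "\<tau> (x * y) = \<tau> x * \<tau> y" for x y
    using assms(1) by (auto simp: field_automorphism_def)
  then show ?thesis
    by (simp add: MN mult_G2 G2_mult phi_G2_mat G2_mat_inject field_automorphism_power[OF assms(1)]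
        power_mult_distrib algebra_simps)
qed

text \<open>If \<open>\<tau> y\<close> and \<open>\<tau> z\<close> are fixed modulo \<open>b\<^bsup>r+1\<^esup>\<close>, then the coordinates of the image of a quotient of two
elements are multiples of \<open>a b\<close> and of \<open>(a b)\<^bsup>r+1\<^esup>\<close>, which are integral.\<close>

lemma finite_mod_phi_integral:
  assumes \<tau>: "field_automorphism \<tau>" "\<tau> ` F_minus \<subseteq> F_minus"
    and b: "b \<in> F_minus" "b \<noteq> 0" "a * b \<in> F_minus"
  shows "finite_mod G2 {M \<in> G2_integral. phi r \<tau> a M \<in> G2_integral} G2_integral"
proof -
  have hom: "\<tau> (x + y) = \<tau> x + \<tau> y" "\<tau> (x * y) = \<tau> x * \<tau> y" for x y
    using \<tau>(1) by (auto simp: field_automorphism_def)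
  have diff: "\<tau> (x - y) = \<tau> x - \<tau> y" for x y
    using hom(1)[of "x - y" y] by simp
  have cl: "\<tau> x \<in> F_minus" if "x \<in> F_minus" for x using \<tau>(2) that by blast
  have "b ^ (r + 1) \<in> F_minus" "b ^ (r + 1) \<noteq> 0" using b by (auto intro: F_minus_power simp del: power_Suc)
  then obtain c :: "'a fls \<Rightarrow> 'a fls" where c: "finite (c ` F_minus)"
    "\<And>f g. f \<in> F_minus \<Longrightarrow> g \<in> F_minus \<Longrightarrow> c f = c g \<Longrightarrow> \<exists>h\<in>F_minus. f - g = b ^ (r + 1) * h"
    by (rule finite_colouring_mod) blast
  have clear1: "a * (b ^ (r + 1) * h) \<in> F_minus" if "h \<in> F_minus" for h
  proof -
    have "a * (b ^ (r + 1) * h) = a * b * (b ^ r * h)" by (simp add: mult_ac)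
    then show ?thesis using b that by (simp only: F_minus_mult F_minus_power)
  qed
  have clear2: "a ^ (r + 1) * (b ^ (r + 1) * h) \<in> F_minus" if "h \<in> F_minus" for h
  proof -
    have "a ^ (r + 1) * (b ^ (r + 1) * h) = (a * b) ^ (r + 1) * h" by (simp only: power_mult_distrib mult_ac)
    then show ?thesis using b that by (simp only: F_minus_mult F_minus_power)
  qed
  define C where "C M = (c (\<tau> (y_coord M)), c (\<tau> (M $ 1 $ 3)))" for M :: "'a fls ^ 3 ^ 3"
  show ?thesis
  proof (rule finite_modI[of C])
    have "C ` G2_integral \<subseteq> c ` F_minus \<times> c ` F_minus"
      by (auto simp: C_def G2_integral_iff cl)
    then show "finite (C ` G2_integral)" by (rule finite_subset) (use c in simp)
    fix M N assume M: "M \<in> G2_integral" and N: "N \<in> G2_integral" and eq: "C M = C N"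
    obtain y z where yz: "y \<in> F_minus" "z \<in> F_minus" "M = G2_mat r y z" using M by (auto simp: G2_integral_iff)
    obtain y' z' where yz': "y' \<in> F_minus" "z' \<in> F_minus" "N = G2_mat r y' z'" using N by (auto simp: G2_integral_iff)
    have "c (\<tau> y) = c (\<tau> y')" "c (\<tau> z) = c (\<tau> z')" using eq by (simp_all add: C_def yz(3) yz'(3))
    then obtain h h' where h: "h \<in> F_minus" "\<tau> y - \<tau> y' = b ^ (r + 1) * h"
      and h': "h' \<in> F_minus" "\<tau> z - \<tau> z' = b ^ (r + 1) * h'"
      using c(2)[OF cl[OF yz(1)] cl[OF yz'(1)]] c(2)[OF cl[OF yz(2)] cl[OF yz'(2)]] by blast
    have "a * (\<tau> y - \<tau> y') \<in> F_minus" unfolding h by (rule clear1[OF h(1)])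
    moreover have "a ^ (r + 1) * (\<tau> z - \<tau> z' - (\<tau> y - \<tau> y') ^ r * \<tau> y') \<in> F_minus"
    proof -
      define g where "g = h' - (b ^ (r + 1)) ^ (r - 1) * h ^ r * \<tau> y'"
      have "(b ^ (r + 1)) ^ r = b ^ (r + 1) * (b ^ (r + 1)) ^ (r - 1)"
        using r_pos by (metis power_minus_mult mult.commute)
      then have "\<tau> z - \<tau> z' - (\<tau> y - \<tau> y') ^ r * \<tau> y' = b ^ (r + 1) * g"
        unfolding h h' g_def power_mult_distrib[of "b ^ (r + 1)" h r] right_diff_distrib by (simp only: mult.assoc)
      moreover have "g \<in> F_minus" unfolding g_def
        by (intro F_minus_diff F_minus_mult F_minus_power h h' b cl yz')
      ultimately show ?thesis using clear2 by simp
    qed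
    ultimately have "phi r \<tau> a (M \<otimes>\<^bsub>G2\<^esub> inv\<^bsub>G2\<^esub> N) \<in> G2_integral"
      unfolding G2_integral_iff yz(3) yz'(3) div_G2 phi_G2_mat
      by (simp only: diff hom field_automorphism_power[OF \<tau>(1)]) blast
    moreover have "M \<otimes>\<^bsub>G2\<^esub> inv\<^bsub>G2\<^esub> N \<in> G2_integral"
      by (rule G2.subgroup_div[OF subgroup_G2_integral M N])
    ultimately show "M \<otimes>\<^bsub>G2\<^esub> inv\<^bsub>G2\<^esub> N \<in> {M \<in> G2_integral. phi r \<tau> a M \<in> G2_integral}" by simp
  qed
qed

lemma central_G2: "M \<in> carrier G2 \<Longrightarrow> N \<in> carrier G2 \<Longrightarrow> y_coord M = 0 \<Longrightarrow> M ** N = N ** M"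
  by (elim G2_mat_cases) (use r_pos in \<open>simp add: G2_mult zero_power add.commute\<close>)

end

lemma CHAR_finite_field:
  assumes "prime p" "CARD('a::{field,finite}) = p ^ m"
  shows "CHAR('a) = p"
proof -
  have "prime CHAR('a)" by (rule prime_CHAR_semidom) (rule finite_imp_CHAR_pos, simp)
  moreover have "CHAR('a) dvd p ^ m"
  proof -
    have "(\<Sum>x\<in>UNIV. x + 1) = (\<Sum>x\<in>UNIV. x :: 'a)"
      by (rule sum.reindex_bij_witness[of _ "\<lambda>x. x - 1" "\<lambda>x. x + 1"]) auto
    then have "of_nat CARD('a) = (0 :: 'a)" by (simp add: sum.distrib)
    then show ?thesis by (simp only: of_nat_eq_0_iff_char_dvd assms(2))
  qed
  ultimately show ?thesis using assms(1) by (metis prime_dvd_power primes_dvd_imp_eq)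
qed

text \<open>The subgroup \<open>H1\<close> consists of the integral elements with integral image under \<open>lam\<close>.  On it \<open>lam\<close> and
\<open>\<phi>\<^sub>\<tau>\<^sub>,\<^sub>a\<close> agree in the first coordinate, so their quotient \<open>\<zeta>\<close> has central values and is a
homomorphism.  The values of \<open>\<zeta>\<close> lie in \<open>\<Gamma>\<close> only where \<open>\<phi>\<^sub>\<tau>\<^sub>,\<^sub>a\<close> does, which defines \<open>\<Gamma>'\<close>.\<close>

theorem theorem1p11:
  fixes p q r m k :: nat
    and \<Gamma> \<Gamma>1 :: "('a::{field,finite} fls ^ 3 ^ 3) set"
    and lam :: "'a fls ^ 3 ^ 3 \<Rightarrow> 'a fls ^ 3 ^ 3"
  assumes "prime p" and "q = p ^ m" and "r = p ^ k" and "r > 2"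
    and "CARD('a) = q"
    and "arithmetic_subgroup \<Gamma> (G2_set r)" and "lattice_in \<Gamma> (G2_set r)"
    and "virtual_automorphism (matrix_group \<Gamma>) \<Gamma>1 lam"
  shows "\<exists>(\<tau> :: 'a fls \<Rightarrow> 'a fls) a \<Gamma>' \<zeta>.
           field_automorphism \<tau> \<and> continuous_on UNIV \<tau> \<and> a \<noteq> 0 \<and> standard \<tau> a \<and>
           finite_index_subgroup \<Gamma>' (matrix_group \<Gamma>) \<and> \<Gamma>' \<subseteq> \<Gamma>1 \<and>
           \<zeta> \<in> hom (matrix_group \<Gamma>') (matrix_group (group_center (matrix_group \<Gamma>))) \<and>
           (\<forall>\<gamma>\<in>\<Gamma>'. lam \<gamma> = phi r \<tau> a \<gamma> ** \<zeta> \<gamma>)"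
proof -
  interpret frobenius_power r k "TYPE('a)"
    by unfold_locales (use assms CHAR_finite_field[of p m] in auto)
  let ?G = "G2 :: ('a fls ^ 3 ^ 3) monoid"
  have restrict: "matrix_group K = ?G\<lparr>carrier := K\<rparr>" for K :: "('a fls ^ 3 ^ 3) set"
    by (simp add: matrix_group_def)
  have sub_mono: "subgroup H (matrix_group K) \<longleftrightarrow> subgroup H ?G \<and> H \<subseteq> K" if "subgroup K ?G" for H K
    using G2.incl_subgroup[OF that, of H] G2.subgroup_incl[OF _ that, of H] subgroup.subset[of H "matrix_group K"]
    unfolding restrict[of K] by auto
  have fin_iff: "finite_index_subgroup H (matrix_group K) \<longleftrightarrow> subgroup H ?G \<and> H \<subseteq> K \<and> finite_mod ?G H K"
    if "subgroup K ?G" for H K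
    unfolding finite_index_subgroup_def sub_mono[OF that]
    using G2.finite_rcosets_iff_finite_mod[OF _ that, of H] unfolding restrict[of K] by blast
  let ?L = "G2_integral"
  define A where "A = \<Gamma> \<inter> GL_over F_minus"
  have \<Gamma>: "subgroup \<Gamma> ?G" and "finite_index_subgroup A (matrix_group \<Gamma>)" and "finite_index_subgroup A (matrix_group ?L)"
    using assms(6) by (auto simp: arithmetic_subgroup_def A_def G2_integral_def)
  then have A: "subgroup A ?G" "A \<subseteq> \<Gamma>" "finite_mod ?G A \<Gamma>" "A \<subseteq> ?L" "finite_mod ?G A ?L"
    using fin_iff[OF \<Gamma>] fin_iff[OF subgroup_G2_integral] by auto
  have \<Gamma>G: "\<Gamma> \<subseteq> carrier ?G" by (rule subgroup.subset[OF \<Gamma>])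
  obtain \<Gamma>2 where "finite_index_subgroup \<Gamma>1 (matrix_group \<Gamma>)" "finite_index_subgroup \<Gamma>2 (matrix_group \<Gamma>)"
    and iso: "lam \<in> iso (matrix_group \<Gamma>\<lparr>carrier := \<Gamma>1\<rparr>) (matrix_group \<Gamma>\<lparr>carrier := \<Gamma>2\<rparr>)"
    using assms(8) by (auto simp: virtual_automorphism_def)
  then have \<Gamma>1: "subgroup \<Gamma>1 ?G" "\<Gamma>1 \<subseteq> \<Gamma>" "finite_mod ?G \<Gamma>1 \<Gamma>"
    and \<Gamma>2: "subgroup \<Gamma>2 ?G" "\<Gamma>2 \<subseteq> \<Gamma>" "finite_mod ?G \<Gamma>2 \<Gamma>"
    using fin_iff[OF \<Gamma>] by auto
  have bij: "bij_betw lam \<Gamma>1 \<Gamma>2" and hom: "\<And>M N. M \<in> \<Gamma>1 \<Longrightarrow> N \<in> \<Gamma>1 \<Longrightarrow> lam (M \<otimes>\<^bsub>?G\<^esub> N) = lam M \<otimes>\<^bsub>?G\<^esub> lam N"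
    using iso by (auto simp: iso_def hom_def matrix_group_def)
  have lam\<Gamma>: "lam M \<in> \<Gamma>" if "M \<in> \<Gamma>1" for M using that bij \<Gamma>2(2) by (auto simp: bij_betw_def)
  have lamG: "lam M \<in> carrier ?G" if "M \<in> \<Gamma>1" for M using lam\<Gamma>[OF that] \<Gamma>G by blast
  define H1 where "H1 = A \<inter> {M \<in> \<Gamma>1. lam M \<in> A}"
  define H2 where "H2 = lam ` H1"
  have H1sub: "H1 \<subseteq> \<Gamma>1" "H1 \<subseteq> A" "H1 \<subseteq> \<Gamma>" "H1 \<subseteq> ?L" using A by (auto simp: H1_def)
  have H2sub: "H2 \<subseteq> \<Gamma>2" "H2 \<subseteq> A" "H2 \<subseteq> \<Gamma>" "H2 \<subseteq> ?L" using A bij by (auto simp: H1_def H2_def bij_betw_def)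
  have H1: "subgroup H1 ?G"
    unfolding H1_def by (rule G2.subgroups_Inter_pair[OF A(1) G2.subgroup_vimage[OF \<Gamma>1(1) A(1) lamG hom]])
  have H2: "subgroup H2 ?G"
    unfolding H2_def by (rule G2.subgroup_image[OF H1]) (use H1sub lamG hom in blast)+
  have fin1: "finite_mod ?G H1 \<Gamma>1"
    unfolding H1_def
  proof (rule finite_mod_Int)
    show "finite_mod ?G A \<Gamma>1" by (rule finite_mod_mono[OF A(3) \<Gamma>1(2)]) simp
    show "finite_mod ?G {M \<in> \<Gamma>1. lam M \<in> A} \<Gamma>1"
      by (rule G2.finite_mod_vimage[OF \<Gamma>1(1) lam\<Gamma> \<Gamma>G hom A(3)])
  qed
  have integral: "finite_mod ?G H ?L" if "finite_mod ?G H K" "finite_mod ?G K \<Gamma>" "K \<subseteq> \<Gamma>" for H K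
  proof -
    have "finite_mod ?G H \<Gamma>" by (rule G2.finite_mod_trans[OF \<Gamma>G _ that(2,1)]) (use that(3) \<Gamma>G in blast)
    then have HA: "finite_mod ?G H A" by (rule finite_mod_mono[OF _ A(2)]) simp
    show ?thesis
      by (rule G2.finite_mod_trans[OF G2_integral_carrier _ A(5) HA]) (use A(2) \<Gamma>G in blast)
  qed
  have "finite_mod ?G H2 \<Gamma>2"
    using G2.finite_mod_image[OF \<Gamma>1(1) lamG hom fin1 H1sub(1)] bij by (simp add: H2_def bij_betw_def)
  then have fin2: "finite_mod ?G H2 ?L" by (rule integral[OF _ \<Gamma>2(3,2)])
  have fin1L: "finite_mod ?G H1 ?L" by (rule integral[OF fin1 \<Gamma>1(3,2)])
  have bij': "bij_betw lam H1 H2"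
    unfolding H2_def by (rule inj_on_imp_bij_betw) (use bij H1sub in \<open>auto simp: bij_betw_def intro: inj_on_subset\<close>)
  obtain \<tau> a where \<tau>: "field_automorphism \<tau>" "continuous_on UNIV \<tau>" "a \<noteq> 0" "standard \<tau> a" "\<tau> ` F_minus \<subseteq> F_minus"
    and y: "\<And>M. M \<in> H1 \<Longrightarrow> y_coord (lam M) = a * \<tau> (y_coord M)"
    by (rule standard_map_on_y_coords[OF H1 H1sub(4) fin1L H2 H2sub(4) fin2 bij'])
      (use hom H1sub in blast)+
  let ?\<phi> = "phi r \<tau> a"
  obtain b where b: "b \<in> F_minus" "b \<noteq> 0" "a * b \<in> F_minus" using \<tau>(4) by (auto simp: standard_def)
  define J where "J = H1 \<inter> {M \<in> ?L. ?\<phi> M \<in> ?L}"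
  define \<Gamma>' where "\<Gamma>' = {M \<in> J. ?\<phi> M \<in> A}"
  have H1G: "H1 \<subseteq> carrier ?G" and JG: "J \<subseteq> carrier ?G" using H1sub \<Gamma>G by (auto simp: J_def)
  have LG: "M \<in> carrier ?G" if "M \<in> ?L" for M using that G2_integral_carrier by blast
  have J: "subgroup J ?G"
    unfolding J_def
    by (rule G2.subgroups_Inter_pair[OF H1 G2.subgroup_vimage[OF subgroup_G2_integral subgroup_G2_integral]])
      (use LG phi_G2_closed phi_mult[OF \<tau>(1)] in blast)+
  have \<Gamma>'G2: "subgroup \<Gamma>' ?G"
    unfolding \<Gamma>'_def by (rule G2.subgroup_vimage[OF J A(1)]) (use JG phi_G2_closed phi_mult[OF \<tau>(1)] in blast)+
  have "finite_mod ?G J H1"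
    unfolding J_def
  proof (rule finite_mod_Int)
    show "finite_mod ?G H1 H1"
      by (rule finite_modI[of "\<lambda>_. ()"]) (use G2.subgroup_div[OF H1] in auto)
    show "finite_mod ?G {M \<in> ?L. ?\<phi> M \<in> ?L} H1"
      by (rule finite_mod_mono[OF finite_mod_phi_integral[OF \<tau>(1,5) b] H1sub(4)]) simp
  qed
  moreover have "finite_mod ?G \<Gamma>' J"
    unfolding \<Gamma>'_def
  proof (rule G2.finite_mod_vimage[OF J _ G2_integral_carrier _ A(5)])
    show "?\<phi> M \<in> ?L" if "M \<in> J" for M using that by (simp add: J_def)
    show "?\<phi> (M \<otimes>\<^bsub>?G\<^esub> N) = ?\<phi> M \<otimes>\<^bsub>?G\<^esub> ?\<phi> N" if "M \<in> J" "N \<in> J" for M N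
      using that JG by (intro phi_mult[OF \<tau>(1)]) auto
  qed
  ultimately have "finite_mod ?G \<Gamma>' H1" by (rule G2.finite_mod_trans[OF H1G JG])
  moreover have "finite_mod ?G H1 \<Gamma>"
    by (rule G2.finite_mod_trans[OF \<Gamma>G _ \<Gamma>1(3) fin1]) (use \<Gamma>1(2) \<Gamma>G in blast)
  ultimately have fin: "finite_mod ?G \<Gamma>' \<Gamma>" by (metis G2.finite_mod_trans \<Gamma>G H1G)
  have \<Gamma>'sub: "\<Gamma>' \<subseteq> H1" "\<Gamma>' \<subseteq> \<Gamma>1" "\<Gamma>' \<subseteq> \<Gamma>" using H1sub by (auto simp: \<Gamma>'_def J_def)
  define \<zeta> where "\<zeta> M = inv\<^bsub>?G\<^esub> ?\<phi> M \<otimes>\<^bsub>?G\<^esub> lam M" for M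
  have in_G: "M \<in> carrier ?G" "?\<phi> M \<in> carrier ?G" "lam M \<in> carrier ?G" "?\<phi> M \<in> \<Gamma>" "lam M \<in> \<Gamma>"
    if "M \<in> \<Gamma>'" for M
    using that \<Gamma>'sub \<Gamma>G phi_G2_closed lam\<Gamma> lamG A(2) by (auto simp: \<Gamma>'_def)
  have \<zeta>\<Gamma>: "\<zeta> M \<in> \<Gamma>" if "M \<in> \<Gamma>'" for M
    unfolding \<zeta>_def using in_G[OF that] \<Gamma> by (simp add: subgroup.m_closed subgroup.m_inv_closed)
  have \<zeta>G: "\<zeta> M \<in> carrier ?G" if "M \<in> \<Gamma>'" for M using \<zeta>\<Gamma>[OF that] \<Gamma>G by blast
  have lam_eq: "lam M = ?\<phi> M \<otimes>\<^bsub>?G\<^esub> \<zeta> M" if "M \<in> \<Gamma>'" for M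
    using in_G[OF that] by (simp add: \<zeta>_def flip: G2.m_assoc)
  have y\<zeta>: "y_coord (\<zeta> M) = 0" if M: "M \<in> \<Gamma>'" for M
  proof -
    obtain u v where "M = G2_mat r u v" using in_G(1)[OF M] by (rule G2_mat_cases)
    then have "y_coord (?\<phi> M) = y_coord (lam M)" using y[of M] M \<Gamma>'sub by (auto simp: phi_G2_mat)
    moreover have "y_coord (lam M) = y_coord (?\<phi> M) + y_coord (\<zeta> M)"
      using y_coord_mult[OF in_G(2)[OF M] \<zeta>G[OF M]] lam_eq[OF M] by simp
    ultimately show ?thesis by simp
  qed
  have central: "\<zeta> M \<otimes>\<^bsub>?G\<^esub> N = N \<otimes>\<^bsub>?G\<^esub> \<zeta> M" if "M \<in> \<Gamma>'" "N \<in> carrier ?G" for M N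
    unfolding mult_G2 by (rule central_G2[OF \<zeta>G[OF that(1)] that(2) y\<zeta>[OF that(1)]])
  have \<zeta>hom: "\<zeta> (M \<otimes>\<^bsub>?G\<^esub> N) = \<zeta> M \<otimes>\<^bsub>?G\<^esub> \<zeta> N" if M: "M \<in> \<Gamma>'" and N: "N \<in> \<Gamma>'" for M N
  proof -
    have MN: "M \<otimes>\<^bsub>?G\<^esub> N \<in> \<Gamma>'" by (rule subgroup.m_closed[OF \<Gamma>'G2 M N])
    have "?\<phi> (M \<otimes>\<^bsub>?G\<^esub> N) \<otimes>\<^bsub>?G\<^esub> \<zeta> (M \<otimes>\<^bsub>?G\<^esub> N) = lam M \<otimes>\<^bsub>?G\<^esub> lam N"
      using lam_eq[OF MN] hom[of M N] M N \<Gamma>'sub by auto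
    also have "\<dots> = ?\<phi> M \<otimes>\<^bsub>?G\<^esub> (\<zeta> M \<otimes>\<^bsub>?G\<^esub> ?\<phi> N) \<otimes>\<^bsub>?G\<^esub> \<zeta> N"
      using in_G[OF M] in_G[OF N] \<zeta>G[OF M] \<zeta>G[OF N] by (simp add: lam_eq[OF M] lam_eq[OF N] G2.m_assoc)
    also have "\<dots> = ?\<phi> (M \<otimes>\<^bsub>?G\<^esub> N) \<otimes>\<^bsub>?G\<^esub> (\<zeta> M \<otimes>\<^bsub>?G\<^esub> \<zeta> N)"
      using in_G[OF M] in_G[OF N] \<zeta>G[OF M] \<zeta>G[OF N]
      by (simp add: central[OF M] phi_mult[OF \<tau>(1)] G2.m_assoc)
    finally show ?thesis
      using in_G(2)[OF MN] \<zeta>G[OF M] \<zeta>G[OF N] \<zeta>G[OF MN] by simp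
  qed
  have "\<zeta> \<in> hom (matrix_group \<Gamma>') (matrix_group (group_center (matrix_group \<Gamma>)))"
  proof (rule homI)
    show "\<zeta> M \<in> carrier (matrix_group (group_center (matrix_group \<Gamma>)))" if "M \<in> carrier (matrix_group \<Gamma>')" for M
      using that \<zeta>\<Gamma> central \<Gamma>G unfolding mult_G2 by (auto simp: group_center_def matrix_group_def)
    show "\<zeta> (M \<otimes>\<^bsub>matrix_group \<Gamma>'\<^esub> N) = \<zeta> M \<otimes>\<^bsub>matrix_group (group_center (matrix_group \<Gamma>))\<^esub> \<zeta> N"
      if "M \<in> carrier (matrix_group \<Gamma>')" "N \<in> carrier (matrix_group \<Gamma>')" for M N
      using that \<zeta>hom unfolding mult_G2 by (simp add: matrix_group_def)
  qed
  moreover have "finite_index_subgroup \<Gamma>' (matrix_group \<Gamma>)"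
    using fin_iff[OF \<Gamma>] \<Gamma>'G2 \<Gamma>'sub fin by blast
  ultimately show ?thesis
    using \<tau> \<Gamma>'sub lam_eq unfolding mult_G2 by blast
qed

end
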